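(* Let $n\geq 3$ and let $K$ be an algebraically closed field of characteristic zero. Then for every nonzero multilinear polynomial $f(x_1,x_2,x_3,x_4)\in K\langle x_1,x_2,x_3,x_4\rangle$, the image $f(M_n(K))$ contains $sl_n(K)$.
   Context: $K\langle x_1,\dots,x_4\rangle$ is the free associative algebra on noncommuting variables. A polynomial is multilinear if it has the form $\sum_{\sigma\in S_4}\alpha_\sigma x_{\sigma(1)}x_{\sigma(2)}x_{\sigma(3)}x_{\sigma(4)}$ with $\alpha_\sigma\in K$. $f(M_n(K))=\{f(a_1,\dots,a_4): a_i\in M_n(K)\}$, and $sl_n(K)$ is the set of trace zero $n\times n$ matrices over $K$. *)

theory Defs
  imports "HOL-Analysis.Analysis" "HOL-Computational_Algebra.Polynomial"
begin

definition smat :: "'a::times \<Rightarrow> 'a^'n^'n \<Rightarrow> 'a^'n^'n" where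
  "smat c M = (\<chi> i j. c * M $ i $ j)"

definition eval_multilin4 :: "((nat \<Rightarrow> nat) \<Rightarrow> 'a::comm_ring_1) \<Rightarrow> (nat \<Rightarrow> 'a^'n^'n) \<Rightarrow> 'a^'n^'n" where
  "eval_multilin4 \<alpha> a =
     (\<Sum>\<sigma> \<in> {\<sigma>. \<sigma> permutes {0..<4}}. smat (\<alpha> \<sigma>) (a (\<sigma> 0) ** a (\<sigma> 1) ** a (\<sigma> 2) ** a (\<sigma> 3)))"

end

theory Submission
  imports Defs "Jordan_Normal_Form.Jordan_Normal_Form_Existence"
begin

text \<open>
  The image of \<open>f\<close> is closed under conjugation and does not change under relabelling of the variables.

  If the coefficients are not antisymmetric in the first two or in the last two letters, then diagonal
  matrices \<open>diag(u\<^sup>i)\<close>, \<open>diag(u\<^sup>2\<^sup>i)\<close>, \<open>diag(u\<^sup>4\<^sup>i)\<close> in three variables turn \<open>f\<close> into an entrywise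
  rescaling of the fourth one with nonzero factors off the diagonal. So all matrices with zero diagonal are
  values, and every trace zero matrix is similar to one of these.

  If they are antisymmetric there but not in the middle letters, then equating the middle variables to the
  nilpotent shift \<open>D\<close> turns \<open>f\<close> into \<open>p (U V + q V U)\<close> with \<open>U\<close>, \<open>V\<close> arbitrary in the range of \<open>[\<cdot>, D]\<close>.
  A Jordan form of the target with suitably ordered eigenvalues is reached with \<open>U\<close> diagonal if \<open>q \<noteq> -1\<close>,
  and with \<open>U\<close> a weighted shift if \<open>q = -1\<close>.

  Otherwise \<open>f\<close> is a multiple of the standard polynomial. With the shift, the shift with weights \<open>i\<close> and
  a generic diagonal matrix orthogonal to the eigenvalues in three variables, the equation for the
  fourth one can be solved row by row. For nilpotent targets, one weighted shift and two diagonal matrices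
  suffice.
\<close>

text \<open>Each substitution answers the degeneration of the one before. If both ends are
  antisymmetric, three commuting values kill \<open>f\<close>, since each monomial cancels against
  the one with two commuting end letters exchanged. If the middle is antisymmetric as well, equal
  middle variables kill \<open>f\<close>. Two obstructions shape the rest. A matrix lies in the
  range of \<open>[\<cdot>, D]\<close> only if its sums along the main diagonal and along every
  subdiagonal vanish; for an upper triangular matrix this leaves only the trace, which is why
  targets are triangular. In the standard polynomial with two shifts and \<open>diag d\<close>, a
  value \<open>M\<close> satisfies \<open>\<Sum> d i * M i i = 0\<close> in addition to trace zero,
  which forces \<open>d\<close> to be orthogonal to the eigenvalues. The eigenvalues are listed so
  that such a \<open>d\<close> can still keep all divisors nonzero, and so that the last two differ,
  which one final conjugation needs. Nilpotent targets have no such listing and are treated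
  separately. Algebraic closedness provides the Jordan form and the root of one auxiliary
  polynomial.\<close>

no_notation vec_index (infixl "$" 100)

section \<open>Jordan form over an algebraically closed field\<close>

text \<open>One step of triangularisation: the new basis is \<open>v\<close> together with all
  standard basis vectors except the \<open>k\<close>-th, where \<open>k\<close> is a position at
  which \<open>v\<close> is nonzero.\<close>

lemma mat_first_column_eigenvector:
  fixes A :: "'a :: field mat"
  assumes A: "A \<in> carrier_mat n n" and ev: "eigenvector A v e"
  obtains B where "B \<in> carrier_mat n n" "similar_mat A B"
    "\<And>i. i < n \<Longrightarrow> B $$ (i, 0) = (if i = 0 then e else 0)"
proof -
  from ev A have v: "v \<in> carrier_vec n" "v \<noteq> 0\<^sub>v n" and Av: "A *\<^sub>v v = e \<cdot>\<^sub>v v"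
    by (auto simp: eigenvector_def)
  have n0: "0 < n"
    using v by (cases n) auto
  obtain k where k: "k < n" "vec_index v k \<noteq> 0"
    using v by (metis eq_vecI carrier_vecD index_zero_vec(1) zero_carrier_vec)
  define \<sigma> where "\<sigma> = Transposition.transpose 0 k"
  have \<sigma>: "\<sigma> i = 0 \<longleftrightarrow> i = k" "\<sigma> i = k \<longleftrightarrow> i = 0" "\<sigma> i = \<sigma> j \<longleftrightarrow> i = j"
    "i < n \<Longrightarrow> \<sigma> i < n" for i j
    using k n0 by (auto simp: \<sigma>_def Transposition.transpose_def split: if_splits)
  define W where "W = mat n n (\<lambda>(i, j). if j = 0 then vec_index v i else if i = \<sigma> j then 1 else 0)"
  \<comment> \<open>Coordinates in the new basis: the coefficient of \<open>v\<close> is read off at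
    position \<open>k\<close>, and its contribution is then subtracted from the other
    coordinates.\<close>
  define W' where "W' = mat n n (\<lambda>(a, i). if a = 0 then (if i = k then 1 / vec_index v k else 0)
     else (if i = \<sigma> a then 1 else 0) - (if i = k then vec_index v (\<sigma> a) / vec_index v k else 0))"
  have W: "W \<in> carrier_mat n n" and W': "W' \<in> carrier_mat n n"
    by (auto simp: W_def W'_def)
  have W'W: "W' * W = 1\<^sub>m n"
  proof (rule eq_matI)
    fix i j assume ij: "i < dim_row (1\<^sub>m n)" "j < dim_col (1\<^sub>m n)"
    have "(W' * W) $$ (i, j) = (\<Sum>l = 0..<n. W' $$ (i, l) * W $$ (l, j))"
      using ij W W' by (simp add: scalar_prod_def)
    also have "\<dots> = (\<Sum>l = 0..<n. if i = 0 then (if l = k then W $$ (l, j) / vec_index v k else 0)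
       else (if l = \<sigma> i then W $$ (l, j) else 0)
          - (if l = k then W $$ (l, j) * vec_index v (\<sigma> i) / vec_index v k else 0))"
      using ij by (intro sum.cong) (auto simp: W'_def)
    also have "\<dots> = (if i = 0 then W $$ (k, j) / vec_index v k
       else W $$ (\<sigma> i, j) - W $$ (k, j) * vec_index v (\<sigma> i) / vec_index v k)"
      using ij k \<sigma>(4)[of i] by (auto simp: sum_subtractf)
    also have "\<dots> = 1\<^sub>m n $$ (i, j)"
      using ij k \<sigma>(4)[of i] \<sigma>(2)[of j] \<sigma>(3)[of i j] by (auto simp: W_def)
    finally show "(W' * W) $$ (i, j) = 1\<^sub>m n $$ (i, j)" .
  qed (use W W' in auto)
  have WW': "W * W' = 1\<^sub>m n"
    using mat_mult_left_right_inverse[OF W' W W'W] .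
  define B where "B = W' * A * W"
  have B: "B \<in> carrier_mat n n"
    using W W' A by (simp add: B_def)
  have "W * B * W' = (W * W') * A * (W * W')"
    using W W' A by (simp add: B_def assoc_mult_mat[of _ n n _ n _ n])
  hence "A = W * B * W'"
    using A by (simp add: WW')
  hence sim: "similar_mat A B"
    unfolding similar_mat_def using similar_mat_witI[OF WW' W'W _ A B W W'] by blast
  have cW: "col W 0 = v"
    using v n0 W by (intro eq_vecI) (auto simp: W_def)
  have "B $$ (i, 0) = (if i = 0 then e else 0)" if i: "i < n" for i
  proof -
    have "col B 0 = W' *\<^sub>v col (A * W) 0"
      using W W' A n0 col_mult2[of W' n n "A * W" n 0] by (simp add: B_def assoc_mult_mat[of _ n n _ n _ n])
    also have "col (A * W) 0 = A *\<^sub>v col W 0"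
      using A W n0 col_mult2[of A n n W n 0] by simp
    also have "W' *\<^sub>v (A *\<^sub>v col W 0) = W' *\<^sub>v (A *\<^sub>v v)"
      by (simp add: cW)
    also have "\<dots> = e \<cdot>\<^sub>v (W' *\<^sub>v col W 0)"
      using W' v by (simp add: cW Av mult_mat_vec[of _ n n])
    also have "W' *\<^sub>v col W 0 = col (W' * W) 0"
      using W W' n0 col_mult2[of W' n n W n 0] by simp
    also have "\<dots> = col (1\<^sub>m n) 0"
      by (simp add: W'W)
    finally have "vec_index (col B 0) i = vec_index (e \<cdot>\<^sub>v col (1\<^sub>m n) 0) i" by simp
    thus ?thesis using i n0 B by auto
  qed
  with B sim show ?thesis by (rule that)
qed

text \<open>An eigenvector in the first column splits off a block of size one, and induction treats
  the remaining block. The triangular form is the input of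
  \<open>triangular_to_jnf_vector\<close>.\<close>

lemma mat_triangularizable:
  fixes A :: "'a :: alg_closed_field mat"
  assumes "A \<in> carrier_mat n n"
  shows "\<exists>B. B \<in> carrier_mat n n \<and> upper_triangular B \<and> similar_mat A B"
  using assms
proof (induction n arbitrary: A)
  case 0
  then show ?case
    by (intro exI[of _ A]) (auto intro: similar_mat_refl)
next
  case (Suc n)
  have "degree (char_poly A) > 0"
    using degree_monic_char_poly[OF Suc.prems] by simp
  then obtain e where "poly (char_poly A) e = 0"
    using alg_closed_imp_poly_has_root by blast
  then obtain v where "eigenvector A v e"
    using eigenvalue_root_char_poly[OF Suc.prems] by (auto simp: eigenvalue_def)
  then obtain B where B: "B \<in> carrier_mat (Suc n) (Suc n)" "similar_mat A B"
    and B0: "\<And>i. i < Suc n \<Longrightarrow> B $$ (i, 0) = (if i = 0 then e else 0)"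
    using mat_first_column_eigenvector[OF Suc.prems] by blast
  obtain B1 B2 B3 B4 where sp: "split_block B 1 1 = (B1, B2, B3, B4)"
    by (cases "split_block B 1 1") auto
  note spl = split_block[OF sp, of n n]
  have BB: "B1 \<in> carrier_mat 1 1" "B2 \<in> carrier_mat 1 n" "B3 \<in> carrier_mat n 1" "B4 \<in> carrier_mat n n"
    "B = four_block_mat B1 B2 B3 B4"
    using spl B by auto
  have B3: "B3 = 0\<^sub>m n 1"
  proof (rule eq_matI)
    fix i j assume "i < dim_row (0\<^sub>m n 1 :: 'a mat)" "j < dim_col (0\<^sub>m n 1 :: 'a mat)"
    hence "B3 $$ (i, j) = B $$ (Suc i, 0)" "i < n" "j = 0"
      using BB(1-4) by (auto simp: BB(5))
    thus "B3 $$ (i, j) = 0\<^sub>m n 1 $$ (i, j)"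
      using B0[of "Suc i"] by simp
  qed (use BB in auto)
  obtain C4 where C4: "C4 \<in> carrier_mat n n" "upper_triangular C4" "similar_mat B4 C4"
    using Suc.IH[OF BB(4)] by blast
  obtain C2 where C2: "C2 \<in> carrier_mat 1 n"
    "similar_mat (four_block_mat B1 B2 (0\<^sub>m n 1) B4) (four_block_mat B1 C2 (0\<^sub>m n 1) C4)"
    using similar_mat_four_block_0_ex[OF similar_mat_refl[OF BB(1)] C4(3) BB(2) BB(1) BB(4)] by blast
  let ?C = "four_block_mat B1 C2 (0\<^sub>m n 1) C4"
  have "similar_mat A ?C"
    using similar_mat_trans[OF B(2)] C2(2) by (simp add: BB(5) B3)
  moreover have "upper_triangular ?C"
    using BB(1) C2(1) C4(1,2) by (auto simp: upper_triangular_def)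
  moreover have "?C \<in> carrier_mat (Suc n) (Suc n)"
    using BB(1) C4(1) four_block_carrier_mat[of B1 1 1 C4 n n C2 "0\<^sub>m n 1"] by simp
  ultimately show ?case by blast
qed

text \<open>The block list is flattened into two sequences because indices are later permuted across
  blocks.\<close>

lemma jordan_matrix_bidiagonal:
  "\<exists>t s. \<forall>i j. i < sum_list (map fst n_as) \<longrightarrow> j < sum_list (map fst n_as) \<longrightarrow>
     jordan_matrix n_as $$ (i, j) = (if i = j then t i else if j = Suc i then s i else 0)
     \<and> s i \<in> {0, 1} \<and> (s i = 1 \<longrightarrow> t i = (t (Suc i) :: 'a :: field))"
proof (induction n_as)
  case Nil
  then show ?case by simp
next
  case (Cons na n_as)
  obtain m a where na: "na = (m, a)" by force
  let ?n = "sum_list (map fst n_as)"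
  obtain t s where ts: "\<And>i j. i < ?n \<Longrightarrow> j < ?n \<Longrightarrow>
     jordan_matrix n_as $$ (i, j) = (if i = j then t i else if j = Suc i then s i else 0)"
     "\<And>i. i < ?n \<Longrightarrow> s i \<in> {0, 1} \<and> (s i = 1 \<longrightarrow> t i = t (Suc i))"
    using Cons.IH by metis
  define t' where "t' = (\<lambda>i. if i < m then a else t (i - m))"
  \<comment> \<open>The last row of the leading block has no \<open>1\<close> beside the diagonal,
    hence the first test is on \<open>Suc i\<close>.\<close>
  define s' where "s' = (\<lambda>i. if Suc i < m then 1 else if i < m then 0 else s (i - m))"
  have J: "jordan_matrix ((m, a) # n_as) = four_block_mat (jordan_block m a) (0\<^sub>m m ?n) (0\<^sub>m ?n m) (jordan_matrix n_as)"
    using jordan_matrix_dim[of n_as] by (simp add: jordan_matrix_def na Let_def)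
  have "jordan_matrix (na # n_as) $$ (i, j) = (if i = j then t' i else if j = Suc i then s' i else 0)
     \<and> s' i \<in> {0, 1} \<and> (s' i = 1 \<longrightarrow> t' i = t' (Suc i))"
    if ij: "i < sum_list (map fst (na # n_as))" "j < sum_list (map fst (na # n_as))" for i j
  proof -
    have ij': "i < m + ?n" "j < m + ?n" using ij by (auto simp: na)
    have Jij: "jordan_matrix (na # n_as) $$ (i, j) = (if i < m then if j < m then jordan_block m a $$ (i, j) else 0
        else if j < m then 0 else jordan_matrix n_as $$ (i - m, j - m))"
      using ij' by (simp add: na J)
    have "jordan_matrix (na # n_as) $$ (i, j) = (if i = j then t' i else if j = Suc i then s' i else 0)"
    proof (cases "i < m \<or> j < m")
      case True
      then show ?thesis unfolding Jij t'_def s'_def by (auto simp: jordan_block_def)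
    next
      case False
      then obtain i' j' where i'j': "i = m + i'" "j = m + j'"
        by (metis le_Suc_ex not_less)
      then show ?thesis
        unfolding Jij t'_def s'_def using ts(1)[of i' j'] ij' by simp
    qed
    moreover have "s' i \<in> {0, 1} \<and> (s' i = 1 \<longrightarrow> t' i = t' (Suc i))"
    proof (cases "i < m")
      case True
      then show ?thesis unfolding s'_def t'_def by simp
    next
      case False
      then obtain i' where i': "i = m + i'"
        by (metis le_Suc_ex not_less)
      then show ?thesis
        unfolding t'_def s'_def using ts(2)[of i'] ij' by simp
    qed
    ultimately show ?thesis by blast
  qed
  then show ?case by blast
qed

lemma mat_similar_bidiagonal:
  fixes A :: "'a :: alg_closed_field mat"
  assumes A: "A \<in> carrier_mat n n"
  obtains t s J where "similar_mat A J" "J \<in> carrier_mat n n"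
    "\<And>i j. i < n \<Longrightarrow> j < n \<Longrightarrow> J $$ (i, j) = (if i = j then t i else if j = Suc i then s i else 0)"
    "\<And>i. i < n \<Longrightarrow> s i = 0 \<or> s i = 1 \<and> t i = t (Suc i)"
proof -
  obtain B where B: "B \<in> carrier_mat n n" "upper_triangular B" "similar_mat A B"
    using mat_triangularizable[OF A] by blast
  let ?v = "triangular_to_jnf_vector B"
  have sim: "similar_mat A (jordan_matrix ?v)"
    using triangular_to_jnf_vector[OF B(1,2)] similar_mat_trans[OF B(3)] by (simp add: jordan_nf_def)
  obtain n' P Q where "{A, jordan_matrix ?v, P, Q} \<subseteq> carrier_mat n' n'"
    using similar_matD[OF sim] by blast
  hence "n' = n" "dim_row (jordan_matrix ?v) = n'"
    using A by auto
  hence d: "sum_list (map fst ?v) = n"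
    by simp
  obtain t s where ts: "\<And>i j. i < n \<Longrightarrow> j < n \<Longrightarrow>
     jordan_matrix ?v $$ (i, j) = (if i = j then t i else if j = Suc i then s i else 0)
     \<and> s i \<in> {0, 1} \<and> (s i = 1 \<longrightarrow> t i = t (Suc i))"
    using jordan_matrix_bidiagonal[of ?v] unfolding d by blast
  show ?thesis
  proof (rule that[OF sim])
    show "jordan_matrix ?v \<in> carrier_mat n n"
      using jordan_matrix_carrier[of ?v] by (simp add: d)
  qed (use ts in auto)
qed

hide_const (open) Matrix.mat Matrix.vec Matrix.row Matrix.col
hide_type (open) Matrix.mat Matrix.vec

section \<open>Similarity, and the symmetries of the image\<close>

definition similar :: "'a::semiring_1^'n^'n \<Rightarrow> 'a^'n^'n \<Rightarrow> bool" where
  "similar A B \<longleftrightarrow> (\<exists>P Q. P ** Q = mat 1 \<and> Q ** P = mat 1 \<and> A = P ** B ** Q)"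

lemma similar_refl: "similar A A"
  unfolding similar_def by (intro exI[of _ "mat 1"]) (simp add: matrix_mul_lid matrix_mul_rid)

lemma similar_sym: assumes "similar A B" shows "similar B A"
proof -
  obtain P Q where PQ: "P ** Q = mat 1" "Q ** P = mat 1" "A = P ** B ** Q"
    using assms by (auto simp: similar_def)
  have "Q ** A ** P = (Q ** P) ** B ** (Q ** P)"
    by (simp add: PQ(3) matrix_mul_assoc)
  then show ?thesis
    unfolding similar_def using PQ by (intro exI[of _ Q] exI[of _ P]) (simp add: matrix_mul_lid matrix_mul_rid)
qed

lemma similar_trans: assumes "similar A B" "similar B C" shows "similar A C"
proof -
  obtain P Q where PQ: "P ** Q = mat 1" "Q ** P = mat 1" "A = P ** B ** Q"
    using assms(1) by (auto simp: similar_def)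
  obtain P' Q' where PQ': "P' ** Q' = mat 1" "Q' ** P' = mat 1" "B = P' ** C ** Q'"
    using assms(2) by (auto simp: similar_def)
  have "(P ** P') ** (Q' ** Q) = P ** (P' ** Q') ** Q" "(Q' ** Q) ** (P ** P') = Q' ** (Q ** P) ** P'"
    by (simp_all add: matrix_mul_assoc)
  hence "(P ** P') ** (Q' ** Q) = mat 1" "(Q' ** Q) ** (P ** P') = mat 1"
    by (simp_all add: PQ PQ' matrix_mul_rid)
  moreover have "A = (P ** P') ** C ** (Q' ** Q)"
    by (simp add: PQ PQ' matrix_mul_assoc)
  ultimately show ?thesis unfolding similar_def by blast
qed

lemma similar_trace: assumes "similar A (B :: 'a::comm_semiring_1^'n^'n)" shows "trace A = trace B"
proof -
  obtain P Q where PQ: "P ** Q = mat 1" "Q ** P = mat 1" "A = P ** B ** Q"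
    using assms by (auto simp: similar_def)
  have "trace A = trace (Q ** (P ** B))"
    by (simp add: PQ(3) trace_mul_sym[of "P ** B"])
  thus ?thesis by (simp add: matrix_mul_assoc PQ(2) matrix_mul_lid)
qed

definition img4 :: "((nat \<Rightarrow> nat) \<Rightarrow> 'a::comm_ring_1) \<Rightarrow> ('a^'n^'n) set" where
  "img4 \<alpha> = range (eval_multilin4 \<alpha>)"

lemma smat_mult_left: "smat c M ** Q = smat c (M ** Q :: 'a::comm_ring_1^'n^'n)"
  by (simp add: smat_def matrix_matrix_mult_def Finite_Cartesian_Product.vec_eq_iff sum_distrib_left mult.assoc)

lemma smat_mult_right: "M ** smat c Q = smat c (M ** Q :: 'a::comm_ring_1^'n^'n)"
  by (simp add: smat_def matrix_matrix_mult_def Finite_Cartesian_Product.vec_eq_iff sum_distrib_left mult.left_commute)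

lemma matrix_add_rdistrib: "(A + B) ** C = A ** C + (B :: 'a::comm_ring_1^'n^'n) ** C"
  by (simp add: matrix_matrix_mult_def Finite_Cartesian_Product.vec_eq_iff sum.distrib distrib_right)

lemma matrix_diff_ldistrib: "A ** (B - C) = A ** B - A ** (C :: 'a::comm_ring_1^'n^'n)"
  by (simp add: matrix_matrix_mult_def Finite_Cartesian_Product.vec_eq_iff sum_subtractf right_diff_distrib)

lemma matrix_diff_rdistrib: "(A - B) ** C = A ** C - (B :: 'a::comm_ring_1^'n^'n) ** C"
  by (simp add: matrix_matrix_mult_def Finite_Cartesian_Product.vec_eq_iff sum_subtractf left_diff_distrib)

lemma matrix_mul_sum_left: "finite S \<Longrightarrow> P ** (\<Sum>s\<in>S. F s) = (\<Sum>s\<in>S. P ** (F s :: 'a::comm_ring_1^'n^'n))"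
  by (induction S rule: finite_induct) (simp_all add: matrix_add_ldistrib)

lemma matrix_mul_sum_right: "finite S \<Longrightarrow> (\<Sum>s\<in>S. F s) ** P = (\<Sum>s\<in>S. (F s :: 'a::comm_ring_1^'n^'n) ** P)"
  by (induction S rule: finite_induct) (simp_all add: matrix_add_rdistrib)

lemma img4_similar:
  fixes A B :: "'a::comm_ring_1^'n^'n"
  assumes "similar A B" "B \<in> img4 \<alpha>" shows "A \<in> img4 \<alpha>"
proof -
  obtain P Q where PQ: "P ** Q = mat 1" "Q ** P = mat 1" "A = P ** B ** Q"
    using assms by (auto simp: similar_def)
  obtain a where a: "B = eval_multilin4 \<alpha> a"
    using assms(2) by (auto simp: img4_def)
  have fin: "finite {\<sigma>::nat\<Rightarrow>nat. \<sigma> permutes {0..<4}}"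
    by (simp add: finite_permutations)
  have step: "(P ** X ** Q) ** (P ** Y ** Q) = P ** (X ** Y) ** Q" for X Y
  proof -
    have "(P ** X ** Q) ** (P ** Y ** Q) = P ** X ** (Q ** P) ** Y ** Q"
      by (simp add: matrix_mul_assoc)
    thus ?thesis by (simp add: PQ matrix_mul_rid matrix_mul_assoc)
  qed
  have "eval_multilin4 \<alpha> (\<lambda>i. P ** a i ** Q) = A"
    unfolding PQ(3) a eval_multilin4_def matrix_mul_sum_left[OF fin] matrix_mul_sum_right[OF fin] step smat_mult_left smat_mult_right
    by simp
  thus ?thesis by (auto simp: img4_def)
qed

text \<open>The variables may be renamed, so the case lemmas can assume that antisymmetry fails at a
  fixed word.\<close>

lemma img4_relabel:
  assumes "\<tau> permutes {0..<4}"
  shows "img4 (\<lambda>\<sigma>. \<alpha> (\<tau> \<circ> \<sigma>)) \<subseteq> (img4 \<alpha> :: ('a::comm_ring_1^'n^'n) set)"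
proof
  fix A :: "'a^'n^'n" assume "A \<in> img4 (\<lambda>\<sigma>. \<alpha> (\<tau> \<circ> \<sigma>))"
  then obtain a where a: "A = eval_multilin4 (\<lambda>\<sigma>. \<alpha> (\<tau> \<circ> \<sigma>)) a"
    by (auto simp: img4_def)
  have "bij \<tau>" using assms by (rule permutes_bij)
  hence [simp]: "inv_into UNIV \<tau> (\<tau> x) = x" for x by (simp add: bij_is_inj)
  have "eval_multilin4 \<alpha> (a \<circ> inv_into UNIV \<tau>) = A"
    unfolding a eval_multilin4_def by (subst setum_permutations_compose_left[OF assms]) simp
  thus "A \<in> img4 \<alpha>" by (auto simp: img4_def)
qed

section \<open>Words in four letters and the expansion of \<open>f\<close>\<close>

definition perm4 :: "nat \<Rightarrow> nat \<Rightarrow> nat \<Rightarrow> nat \<Rightarrow> nat \<Rightarrow> nat" where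
  "perm4 a b c d = (\<lambda>i. if i = 0 then a else if i = 1 then b else if i = 2 then c else if i = 3 then d else i)"

lemma perm4_inject [simp]: "perm4 a b c d = perm4 a' b' c' d' \<longleftrightarrow> a = a' \<and> b = b' \<and> c = c' \<and> d = d'"
proof
  assume e: "perm4 a b c d = perm4 a' b' c' d'"
  show "a = a' \<and> b = b' \<and> c = c' \<and> d = d'"
    using fun_cong[OF e, of 0] fun_cong[OF e, of 1] fun_cong[OF e, of 2] fun_cong[OF e, of 3]
    by (simp add: perm4_def)
qed simp

lemma permutes4_iff: "\<sigma> permutes {0..<4::nat} \<longleftrightarrow>
  (\<exists>a b c d. \<sigma> = perm4 a b c d \<and> {a, b, c, d} \<subseteq> {0..<4} \<and> distinct [a, b, c, d])"
proof
  assume \<sigma>: "\<sigma> permutes {0..<4}"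
  have "\<sigma> i < 4" if "i < 4" for i
    using permutes_in_image[OF \<sigma>, of i] that by simp
  hence "{\<sigma> 0, \<sigma> 1, \<sigma> 2, \<sigma> 3} \<subseteq> {0..<4}"
    by simp
  moreover have "\<sigma> = perm4 (\<sigma> 0) (\<sigma> 1) (\<sigma> 2) (\<sigma> 3)"
    using permutes_not_in[OF \<sigma>] by (auto simp: perm4_def fun_eq_iff)
  moreover have "distinct [\<sigma> 0, \<sigma> 1, \<sigma> 2, \<sigma> 3]"
    by (simp add: inj_eq[OF permutes_inj[OF \<sigma>]])
  ultimately show "\<exists>a b c d. \<sigma> = perm4 a b c d \<and> {a, b, c, d} \<subseteq> {0..<4} \<and> distinct [a, b, c, d]"
    by blast
next
  assume "\<exists>a b c d. \<sigma> = perm4 a b c d \<and> {a, b, c, d} \<subseteq> {0..<4} \<and> distinct [a, b, c, d]"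
  then obtain a b c d where *: "\<sigma> = perm4 a b c d" "{a, b, c, d} \<subseteq> {0..<4}" "distinct [a, b, c, d]" by blast
  have S: "{0..<4} = {0, 1, 2, 3::nat}" by auto
  have "inj_on \<sigma> {0..<4}"
    using *(3) unfolding *(1) S by (auto simp: inj_on_def perm4_def)
  moreover have "\<sigma> ` {0..<4} \<subseteq> {0..<4}"
    using *(2) unfolding *(1) by (auto simp: perm4_def)
  ultimately have "bij_betw \<sigma> {0..<4} {0..<4}"
    by (simp add: bij_betw_def card_image card_subset_eq)
  moreover have "\<sigma> x = x" if "x \<notin> {0..<4}" for x
    using that unfolding *(1) by (auto simp: perm4_def)
  ultimately show "\<sigma> permutes {0..<4}" by (rule bij_imp_permutes)
qed

lemma sum_permutes4:
  fixes g :: "(nat \<Rightarrow> nat) \<Rightarrow> 'b::comm_monoid_add"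
  shows "(\<Sum>\<sigma> | \<sigma> permutes {0..<4}. g \<sigma>) =
    (\<Sum>a\<in>{0,1,2,3}. \<Sum>b\<in>{0,1,2,3}-{a}. \<Sum>c\<in>{0,1,2,3}-{a,b}. \<Sum>d\<in>{0,1,2,3}-{a,b,c}. g (perm4 a b c d))"
proof -
  define S where "S = (SIGMA a:{0,1,2,3}. SIGMA b:{0,1,2,3}-{a}. SIGMA c:{0,1,2,3}-{a,b}. {0,1,2,3::nat}-{a,b,c})"
  have "{\<sigma>. \<sigma> permutes {0..<4}} = (\<lambda>(a, b, c, d). perm4 a b c d) ` S"
  proof -
    define I where "I = {0,1,2,3::nat}"
    have I: "{0..<4} = I" by (auto simp: I_def)
    have "\<sigma> permutes {0..<4} \<longleftrightarrow> (\<exists>a\<in>I. \<exists>b\<in>I-{a}. \<exists>c\<in>I-{a,b}. \<exists>d\<in>I-{a,b,c}. \<sigma> = perm4 a b c d)" for \<sigma>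
      unfolding permutes4_iff unfolding I by simp blast
    thus ?thesis
      unfolding S_def I_def[symmetric] by (auto simp: image_iff) 
  qed
  moreover have "inj_on (\<lambda>(a, b, c, d). perm4 a b c d) S"
    by (auto simp: inj_on_def)
  ultimately have "(\<Sum>\<sigma> | \<sigma> permutes {0..<4}. g \<sigma>) = (\<Sum>(a,b,c,d)\<in>S. g (perm4 a b c d))"
    by (simp add: sum.reindex split_def)
  also have "\<dots> = (\<Sum>a\<in>{0,1,2,3}. \<Sum>b\<in>{0,1,2,3}-{a}. \<Sum>c\<in>{0,1,2,3}-{a,b}. \<Sum>d\<in>{0,1,2,3}-{a,b,c}. g (perm4 a b c d))"
    unfolding S_def by (simp add: sum.Sigma split_def)
  finally show ?thesis .
qed

text \<open>The words are grouped by the order of the letters 1, 2, 3 and then by the place of the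
  letter 0, which will stand for the unknown matrix.\<close>

lemma sum_distinct4:
  fixes G :: "nat \<Rightarrow> nat \<Rightarrow> nat \<Rightarrow> nat \<Rightarrow> 'b::comm_monoid_add"
  shows "(\<Sum>a\<in>{0,1,2,3}. \<Sum>b\<in>{0,1,2,3}-{a}. \<Sum>c\<in>{0,1,2,3}-{a,b}. \<Sum>d\<in>{0,1,2,3}-{a,b,c}. G a b c d)
    = (\<Sum>(b,c,d)\<in>{(1,2,3),(1,3,2),(2,1,3),(2,3,1),(3,1,2),(3,2,1)}.
        G 0 b c d + G b 0 c d + G b c 0 d + G b c d 0)"
  by (simp add: insert_Diff_if ac_simps del: One_nat_def)

text \<open>The factors \<open>mat 1\<close> and the bracketing give every monomial the shape left
  factor, \<open>a 0\<close>, right factor, so that the single rule \<open>shm_fmat_shm\<close>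
  evaluates all of them.\<close>

lemma eval_multilin4_expand:
  fixes a :: "nat \<Rightarrow> 'a::comm_ring_1^'n^'n"
  shows "eval_multilin4 \<alpha> a $ i $ j = (\<Sum>(b,c,d)\<in>{(1,2,3),(1,3,2),(2,1,3),(2,3,1),(3,1,2),(3,2,1)}.
      \<alpha> (perm4 0 b c d) * (mat 1 ** a 0 ** (a b ** a c ** a d)) $ i $ j
    + \<alpha> (perm4 b 0 c d) * (a b ** a 0 ** (a c ** a d)) $ i $ j
    + \<alpha> (perm4 b c 0 d) * (a b ** a c ** a 0 ** a d) $ i $ j
    + \<alpha> (perm4 b c d 0) * (a b ** a c ** a d ** a 0 ** mat 1) $ i $ j)"
proof -
  have s: "(\<Sum>x\<in>S. F x) $ i $ j = (\<Sum>x\<in>S. F x $ i $ j)" for S and F :: "_ \<Rightarrow> 'a^'n^'n"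
    by (induction S rule: infinite_finite_induct) auto
  define G where "G = (\<lambda>p q r s. \<alpha> (perm4 p q r s) * (a p ** a q ** a r ** a s) $ i $ j)"
  have "eval_multilin4 \<alpha> a $ i $ j =
    (\<Sum>p\<in>{0,1,2,3}. \<Sum>q\<in>{0,1,2,3}-{p}. \<Sum>r\<in>{0,1,2,3}-{p,q}. \<Sum>s\<in>{0,1,2,3}-{p,q,r}. G p q r s)"
    unfolding eval_multilin4_def s sum_permutes4 G_def by (simp add: smat_def perm4_def)
  thus ?thesis
    unfolding sum_distinct4 G_def by (simp add: matrix_mul_assoc)
qed

section \<open>Matrices with integer indices and weighted shifts\<close>

text \<open>Rows and columns are numbered by the integers \<open>0..<n\<close>, so that shifted indices such as \<open>i - 1\<close> do not
  truncate. Entry functions may take any values outside of this range.\<close>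

definition idx :: "'n::finite \<Rightarrow> int" where
  "idx = (SOME f. bij_betw f UNIV {0..<int CARD('n)})"

lemma bij_idx: "bij_betw (idx :: 'n::finite \<Rightarrow> int) UNIV {0..<int CARD('n)}"
proof -
  obtain h :: "'n \<Rightarrow> nat" where h: "bij_betw h UNIV {0..<CARD('n)}"
    using ex_bij_betw_finite_nat[of "UNIV :: 'n set"] by auto
  have "bij_betw int {0..<CARD('n)} {0..<int CARD('n)}"
    by (rule bij_betwI[of _ _ _ nat]) auto
  hence "\<exists>f. bij_betw f (UNIV :: 'n set) {0..<int CARD('n)}"
    using bij_betw_trans[OF h] by blast
  thus ?thesis unfolding idx_def by (rule someI_ex)
qed

lemma idx_range: "0 \<le> idx (a :: 'n::finite)" "idx (a :: 'n) < int CARD('n)"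
  using bij_betwE[OF bij_idx] by (metis UNIV_I atLeastLessThan_iff)+

lemma idx_inject [simp]: "idx a = idx b \<longleftrightarrow> a = (b :: 'n::finite)"
  using bij_idx[where 'n='n] by (auto simp: bij_betw_def inj_eq)

lemma idx_surj: "0 \<le> i \<Longrightarrow> i < int CARD('n) \<Longrightarrow> \<exists>a :: 'n::finite. idx a = i"
  using bij_idx[where 'n='n] unfolding bij_betw_def
  by (metis atLeastLessThan_iff imageE)

definition fmat :: "(int \<Rightarrow> int \<Rightarrow> 'a) \<Rightarrow> 'a^'n^'n::finite" where
  "fmat F = (\<chi> a b. F (idx a) (idx b))"

lemma fmat_nth [simp]: "fmat F $ a $ b = F (idx a) (idx b)"
  by (simp add: fmat_def)

lemma fmat_cong:
  assumes "\<And>i j. 0 \<le> i \<Longrightarrow> i < int CARD('n) \<Longrightarrow> 0 \<le> j \<Longrightarrow> j < int CARD('n) \<Longrightarrow> F i j = G i j"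
  shows "(fmat F :: 'a^'n^'n::finite) = fmat G"
  by (simp add: Finite_Cartesian_Product.vec_eq_iff assms idx_range)

lemma fmat_surj: obtains F where "A = (fmat F :: 'a^'n^'n::finite)"
proof -
  have "A = fmat (\<lambda>i j. A $ (inv_into UNIV idx i) $ (inv_into UNIV idx j))"
    by (simp add: Finite_Cartesian_Product.vec_eq_iff inv_into_f_f inj_def)
  thus ?thesis using that by blast
qed

lemma sum_idx: "(\<Sum>k\<in>(UNIV :: 'n::finite set). F (idx k)) = (\<Sum>k\<in>{0..<int CARD('n)}. F k)"
  by (rule sum.reindex_bij_betw[OF bij_idx])

lemma fmat_mult:
  "(fmat F :: 'a::semiring_1^'n^'n::finite) ** fmat G = fmat (\<lambda>i j. \<Sum>k\<in>{0..<int CARD('n)}. F i k * G k j)"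
  by (simp add: Finite_Cartesian_Product.vec_eq_iff matrix_matrix_mult_def
      sum_idx[where F="\<lambda>k. F _ k * G k _"])

lemma trace_fmat: "trace (fmat F :: 'a::semiring_1^'n^'n::finite) = (\<Sum>k\<in>{0..<int CARD('n)}. F k k)"
  by (simp add: trace_def sum_idx[where F="\<lambda>k. F k k"])

lemma mat_1_eq_fmat: "(mat 1 :: 'a::semiring_1^'n^'n::finite) = fmat (\<lambda>i j. if i = j then 1 else 0)"
  by (simp add: Finite_Cartesian_Product.vec_eq_iff Finite_Cartesian_Product.mat_def)

text \<open>\<open>k = 0\<close> gives diagonal matrices and \<open>k = 1\<close> weighted nilpotent
  shifts. Weights are indexed by the row.\<close>

definition shm :: "int \<Rightarrow> (int \<Rightarrow> 'a::zero) \<Rightarrow> 'a^'n^'n::finite" where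
  "shm k w = fmat (\<lambda>i j. if j = i + k then w i else 0)"

lemma mat_1_eq_shm: "(mat 1 :: 'a::semiring_1^'n^'n::finite) = shm 0 (\<lambda>i. 1)"
  by (auto simp: mat_1_eq_fmat shm_def intro!: fmat_cong)

lemma shm_mult_fmat:
  assumes "0 \<le> k"
  shows "(shm k w :: 'a::semiring_1^'n^'n::finite) ** fmat X = fmat (\<lambda>i j. if i + k < int CARD('n) then w i * X (i + k) j else 0)"
  unfolding shm_def fmat_mult
proof (rule fmat_cong)
  fix i j :: int assume i: "0 \<le> i"
  have "(\<Sum>l = 0..<int CARD('n). (if l = i + k then w i else 0) * X l j)
     = (\<Sum>l = 0..<int CARD('n). if l = i + k then w i * X l j else 0)"
    by (intro sum.cong) auto
  thus "(\<Sum>l = 0..<int CARD('n). (if l = i + k then w i else 0) * X l j)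
     = (if i + k < int CARD('n) then w i * X (i + k) j else 0)"
    using i assms by simp
qed

lemma fmat_mult_shm:
  assumes "0 \<le> k"
  shows "(fmat X :: 'a::semiring_1^'n^'n::finite) ** shm k w = fmat (\<lambda>i j. if 0 \<le> j - k then X i (j - k) * w (j - k) else 0)"
  unfolding shm_def fmat_mult
proof (rule fmat_cong)
  fix i j :: int assume j: "0 \<le> j" "j < int CARD('n)"
  have "(\<Sum>l = 0..<int CARD('n). X i l * (if j = l + k then w l else 0))
     = (\<Sum>l = 0..<int CARD('n). if l = j - k then X i l * w l else 0)"
    by (intro sum.cong) auto
  thus "(\<Sum>l = 0..<int CARD('n). X i l * (if j = l + k then w l else 0))
     = (if 0 \<le> j - k then X i (j - k) * w (j - k) else 0)"
    using j assms by simp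
qed

lemma shm_mult:
  assumes "0 \<le> k" "0 \<le> l"
  shows "(shm k w :: 'a::semiring_1^'n^'n::finite) ** shm l v = shm (k + l) (\<lambda>i. w i * v (i + k))"
  unfolding shm_def[of l v] shm_mult_fmat[OF assms(1)] unfolding shm_def
  using assms by (intro fmat_cong) auto

text \<open>Letting \<open>X\<close> vanish outside the matrix replaces case distinctions at the
  border. For nonnegative shifts only two borders can be crossed: rows beyond the last and columns
  before the first.\<close>

lemma shm_fmat_shm:
  assumes "0 \<le> k" "0 \<le> l"
    and "\<And>i j. i \<ge> int CARD('n) \<Longrightarrow> X i j = 0" "\<And>i j. j < 0 \<Longrightarrow> X i j = 0"
  shows "((shm k w :: 'a::semiring_1^'n^'n::finite) ** fmat X ** shm l v) $ a $ b
    = w (idx a) * X (idx a + k) (idx b - l) * v (idx b - l)"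
  unfolding shm_mult_fmat[OF assms(1)] fmat_mult_shm[OF assms(2)]
  using assms(3)[of "idx a + k"] assms(4)[of "idx b - l"] by simp

lemma similar_fmat_bidiagonal:
  fixes A :: "'a::alg_closed_field^'n^'n::finite"
  obtains t s where "similar A (fmat (\<lambda>i j. if i = j then t i else if j = i + 1 then s i else 0))"
    "\<And>i. 0 \<le> i \<Longrightarrow> i < int CARD('n) \<Longrightarrow> s i = 0 \<or> s i = 1 \<and> t i = t (i + 1)"
proof -
  obtain F where A: "A = fmat F" by (rule fmat_surj)
  define n where "n = CARD('n)"
  define A' where "A' = Matrix.mat n n (\<lambda>(i, j). F (int i) (int j))"
  have A': "A' \<in> carrier_mat n n" by (simp add: A'_def)
  obtain t s J where J: "similar_mat A' J" "J \<in> carrier_mat n n"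
    "\<And>i j. i < n \<Longrightarrow> j < n \<Longrightarrow> J $$ (i, j) = (if i = j then t i else if j = Suc i then s i else 0)"
    and ts: "\<And>i. i < n \<Longrightarrow> s i = 0 \<or> s i = 1 \<and> t i = t (Suc i)"
    using mat_similar_bidiagonal[OF A'] by metis
  obtain P Q where PQ: "P \<in> carrier_mat n n" "Q \<in> carrier_mat n n" "P * Q = 1\<^sub>m n" "Q * P = 1\<^sub>m n" "A' = P * J * Q"
    using J(1) A' unfolding similar_mat_def similar_mat_wit_def Let_def by auto
  \<comment> \<open>\<open>G\<close> carries \<open>n\<close> by \<open>n\<close> matrices of the
    Jordan library to the fixed-size type. It is multiplicative there, so similarity is
    transported.\<close>
  define G :: "'a Matrix.mat \<Rightarrow> 'a^'n^'n" where "G = (\<lambda>M. fmat (\<lambda>i j. M $$ (nat i, nat j)))"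
  have Gm: "G (M * M') = G M ** G M'" if "M \<in> carrier_mat n n" "M' \<in> carrier_mat n n" for M M'
    unfolding G_def fmat_mult
  proof (rule fmat_cong)
    fix i j :: int assume ij: "0 \<le> i" "i < int CARD('n)" "0 \<le> j" "j < int CARD('n)"
    hence n: "nat i < n" "nat j < n" by (simp_all add: n_def nat_less_iff)
    have "(M * M') $$ (nat i, nat j) = (\<Sum>k = 0..<n. M $$ (nat i, k) * M' $$ (k, nat j))"
      using that n by (simp add: scalar_prod_def)
    also have "\<dots> = (\<Sum>k = 0..<int n. M $$ (nat i, nat k) * M' $$ (nat k, nat j))"
      by (rule sum.reindex_bij_witness[of _ nat int]) auto
    finally show "(M * M') $$ (nat i, nat j) = (\<Sum>k = 0..<int CARD('n). M $$ (nat i, nat k) * M' $$ (nat k, nat j))"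
      by (simp add: n_def)
  qed
  have G1: "G (1\<^sub>m n) = mat 1"
    unfolding G_def mat_1_eq_fmat by (rule fmat_cong) (auto simp: n_def nat_less_iff)
  have GA: "G A' = A"
    unfolding G_def A A'_def by (rule fmat_cong) (auto simp: n_def nat_less_iff)
  have "similar A (G J)"
    unfolding similar_def
    using Gm[OF PQ(1,2)] Gm[OF PQ(2,1)] Gm[of "P * J" Q] Gm[OF PQ(1) J(2)] PQ J(2) G1 GA
    by (intro exI[of _ "G P"] exI[of _ "G Q"]) auto
  also have "G J = fmat (\<lambda>i j. if i = j then t (nat i) else if j = i + 1 then s (nat i) else 0)"
    unfolding G_def
  proof (rule fmat_cong)
    fix i j :: int assume ij: "0 \<le> i" "i < int CARD('n)" "0 \<le> j" "j < int CARD('n)"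
    hence n: "nat i < n" "nat j < n" by (simp_all add: n_def nat_less_iff)
    have "nat j = Suc (nat i) \<longleftrightarrow> j = i + 1" "nat i = nat j \<longleftrightarrow> i = j"
      using ij by auto
    thus "J $$ (nat i, nat j) = (if i = j then t (nat i) else if j = i + 1 then s (nat i) else 0)"
      using J(3)[OF n] by simp
  qed
  finally show ?thesis
  proof (rule that[of "\<lambda>i. t (nat i)" "\<lambda>i. s (nat i)"])
    fix i :: int assume "0 \<le> i" "i < int CARD('n)"
    thus "s (nat i) = 0 \<or> s (nat i) = 1 \<and> t (nat i) = t (nat (i + 1))"
      using ts[of "nat i"] by (simp add: n_def nat_less_iff nat_add_distrib)
  qed
qed

section \<open>Permutations, transvections and the zero diagonal form\<close>

lemma similar_reindex:
  assumes h: "bij_betw h {0..<int CARD('n)} {0..<int CARD('n)}"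
  shows "similar (fmat F :: 'a::semiring_1^'n^'n::finite) (fmat (\<lambda>i j. F (h i) (h j)))"
proof -
  define P :: "'a^'n^'n" where "P = fmat (\<lambda>i j. if i = h j then 1 else 0)"
  define Q :: "'a^'n^'n" where "Q = fmat (\<lambda>i j. if h i = j then 1 else 0)"
  have hr: "h i \<in> {0..<int CARD('n)}" if "i \<in> {0..<int CARD('n)}" for i
    using bij_betwE[OF h] that by blast
  have hi: "h i = h j \<longleftrightarrow> i = j" if "i \<in> {0..<int CARD('n)}" "j \<in> {0..<int CARD('n)}" for i j
    using h that by (auto simp: bij_betw_def inj_on_def)
  have sum_h: "(\<Sum>k = 0..<int CARD('n). f (h k)) = (\<Sum>k = 0..<int CARD('n). f k)" for f :: "int \<Rightarrow> 'a"
    by (rule sum.reindex_bij_betw[OF h])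
  have "Q ** P = mat 1"
    unfolding P_def Q_def fmat_mult mat_1_eq_fmat
    by (rule fmat_cong) (use hr hi in \<open>auto simp: if_distrib[of "\<lambda>x. x * _"] cong: if_cong\<close>)
  moreover have "P ** Q = mat 1"
    unfolding P_def Q_def fmat_mult mat_1_eq_fmat
  proof (rule fmat_cong)
    fix i j :: int assume "0 \<le> i" "i < int CARD('n)" 
    thus "(\<Sum>k = 0..<int CARD('n). (if i = h k then 1 else 0) * (if h k = j then 1 else 0)) = (if i = j then 1 else (0::'a))"
      by (subst sum_h[of "\<lambda>k. (if i = k then 1 else 0) * (if k = j then 1 else 0)"])
        (simp add: if_distrib[of "\<lambda>x. x * _"] cong: if_cong)
  qed
  moreover have "fmat (\<lambda>i j. F (h i) (h j)) = Q ** fmat F ** P"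
    unfolding P_def Q_def fmat_mult
    by (rule fmat_cong)
      (use hr in \<open>auto simp: if_distrib[of "\<lambda>x. x * _"] if_distrib[of "\<lambda>x. _ * x"] cong: if_cong\<close>)
  ultimately have "similar (fmat (\<lambda>i j. F (h i) (h j)) :: 'a^'n^'n) (fmat F)"
    unfolding similar_def by blast
  thus ?thesis by (rule similar_sym)
qed

text \<open>Conjugation by \<open>1 + c E\<close>, where \<open>E\<close> is the matrix unit at
  \<open>(i, j)\<close>: a row operation followed by the inverse column operation. The last term is
  their overlap at \<open>(i, j)\<close>.\<close>

lemma similar_transvection:
  fixes A :: "'a::comm_ring_1^'n^'n::finite"
  assumes ij: "i \<noteq> j"
  shows "similar A (\<chi> k l. A $ k $ l + (if k = i then c * A $ j $ l else 0) - (if l = j then c * A $ k $ i else 0)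
      - (if k = i \<and> l = j then c * c * A $ j $ i else 0))"
proof -
  define E :: "'a \<Rightarrow> 'a^'n^'n" where "E = (\<lambda>c. \<chi> k l. (if k = l then 1 else 0) + (if k = i \<and> l = j then c else 0))"
  have El: "(E c ** M) $ k $ l = M $ k $ l + (if k = i then c * M $ j $ l else 0)" for c M k l
    by (cases "k = i") (simp_all add: E_def matrix_matrix_mult_def distrib_left distrib_right sum.distrib
        if_distrib[of "\<lambda>x. x * _"] if_distrib[of "\<lambda>x. _ * x"] mult.commute cong: if_cong)
  have Er: "(M ** E c) $ k $ l = M $ k $ l + (if l = j then c * M $ k $ i else 0)" for c M k l
    by (cases "l = j") (simp_all add: E_def matrix_matrix_mult_def distrib_left distrib_right sum.distrib
        if_distrib[of "\<lambda>x. x * _"] if_distrib[of "\<lambda>x. _ * x"] mult.commute cong: if_cong)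
  have inv: "E c ** E (- c) = mat 1" for c
    unfolding Finite_Cartesian_Product.vec_eq_iff El using ij by (auto simp: E_def Finite_Cartesian_Product.mat_def)
  have "similar (E c ** A ** E (- c)) A"
    unfolding similar_def using inv[of c] inv[of "- c"] by (intro exI[of _ "E c"] exI[of _ "E (- c)"]) simp
  hence "similar A (E c ** A ** E (- c))" by (rule similar_sym)
  also have "E c ** A ** E (- c) = (\<chi> k l. A $ k $ l + (if k = i then c * A $ j $ l else 0) - (if l = j then c * A $ k $ i else 0)
      - (if k = i \<and> l = j then c * c * A $ j $ i else 0))"
    unfolding Finite_Cartesian_Product.vec_eq_iff Er El using ij by (auto simp: algebra_simps)
  finally show ?thesis .
qed

text \<open>A nonzero entry at \<open>(i, j)\<close> or \<open>(j, i)\<close> can be used to clear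
  the entry at \<open>(i, i)\<close>. If both vanish, the difference of the two diagonal entries
  first creates one.\<close>

lemma similar_zero_diag_entry:
  fixes A :: "'a::field^'n^'n::finite"
  assumes ij: "i \<noteq> j" and d: "A $ i $ i \<noteq> A $ j $ j"
  shows "\<exists>B. similar A B \<and> B $ i $ i = 0 \<and> (\<forall>k. k \<noteq> i \<longrightarrow> k \<noteq> j \<longrightarrow> B $ k $ k = A $ k $ k)"
proof -
  have upper: "\<exists>B. similar A B \<and> B $ i $ i = 0 \<and> (\<forall>k. k \<noteq> i \<longrightarrow> k \<noteq> j \<longrightarrow> B $ k $ k = A $ k $ k)"
    if "A $ i $ j \<noteq> 0" for A :: "'a^'n^'n"
    using similar_transvection[of j i A "A $ i $ i / A $ i $ j"] ij that by force
  show ?thesis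
  proof (cases "A $ j $ i = 0")
    case False
    then show ?thesis
      using similar_transvection[OF ij, of A "- A $ i $ i / A $ j $ i"] ij by force
  next
    case True
    show ?thesis
    proof (cases "A $ i $ j = 0")
      case False
      then show ?thesis by (rule upper)
    next
      case A0: True
      obtain B where B: "similar A B" "B $ i $ j = A $ j $ j - A $ i $ i"
        "\<And>k. k \<noteq> i \<Longrightarrow> k \<noteq> j \<Longrightarrow> B $ k $ k = A $ k $ k"
        using similar_transvection[OF ij, of A 1] ij True A0 by force
      hence "B $ i $ j \<noteq> 0" using d by simp
      from upper[OF this] B show ?thesis
        using similar_trans[OF B(1)] by metis
    qed
  qed
qed

text \<open>In characteristic zero the nonzero diagonal entries of a trace zero matrix cannot all be
  equal. So a nonzero entry can be cleared at the expense of another nonzero one, and the number of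
  nonzero diagonal entries drops.\<close>

lemma similar_hollow:
  fixes A :: "'a::field_char_0^'n^'n::finite"
  assumes "trace A = 0"
  shows "\<exists>B. similar A B \<and> (\<forall>i. B $ i $ i = 0)"
  using assms
proof (induction "card {i. A $ i $ i \<noteq> 0}" arbitrary: A rule: less_induct)
  case less
  show ?case
  proof (cases "\<forall>i. A $ i $ i = 0")
    case True
    then show ?thesis using similar_refl by blast
  next
    case False
    then obtain i where i: "A $ i $ i \<noteq> 0" by blast
    have "\<exists>j. A $ j $ j \<noteq> 0 \<and> A $ j $ j \<noteq> A $ i $ i"
    proof (rule ccontr)
      assume "\<not> ?thesis"
      hence "trace A = (\<Sum>k\<in>{k. A $ k $ k \<noteq> 0}. A $ i $ i)"
        unfolding trace_def by (intro sum.mono_neutral_cong_right) auto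
      hence "of_nat (card {k. A $ k $ k \<noteq> 0}) * A $ i $ i = 0"
        using less.prems by simp
      thus False using i by auto
    qed
    then obtain j where j: "A $ j $ j \<noteq> A $ i $ i" "i \<noteq> j" "A $ j $ j \<noteq> 0" by metis
    obtain B where B: "similar A B" "B $ i $ i = 0" "\<And>k. k \<noteq> i \<Longrightarrow> k \<noteq> j \<Longrightarrow> B $ k $ k = A $ k $ k"
      using similar_zero_diag_entry[of i j A] j by metis
    have "{k. B $ k $ k \<noteq> 0} \<subset> {k. A $ k $ k \<noteq> 0}"
    proof
      show "{k. B $ k $ k \<noteq> 0} \<subseteq> {k. A $ k $ k \<noteq> 0}"
        using B(2,3) j(3) by (metis (mono_tags, lifting) Collect_mono)
      show "{k. B $ k $ k \<noteq> 0} \<noteq> {k. A $ k $ k \<noteq> 0}"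
        using B(2) i by blast
    qed
    hence "card {k. B $ k $ k \<noteq> 0} < card {k. A $ k $ k \<noteq> 0}"
      by (simp add: psubset_card_mono)
    moreover have "trace B = 0"
      using similar_trace[OF B(1)] less.prems by simp
    ultimately obtain C where "similar B C" "\<forall>k. C $ k $ k = 0"
      using less.hyps by blast
    with similar_trans[OF B(1)] show ?thesis by blast
  qed
qed

section \<open>Substitution of diagonal matrices\<close>

lemma exists_power_nonroot:
  fixes p q :: "'a::field_char_0 poly"
  assumes "p \<noteq> 0" "q \<noteq> 0"
  shows "\<exists>u. u \<noteq> 0 \<and> (\<forall>k\<in>{1..n}. poly p (u ^ k) \<noteq> 0 \<and> poly q (u ^ k) \<noteq> 0)"
proof -
  have fin: "finite {u. poly p (u ^ k) = 0}" if "p \<noteq> 0" "k \<ge> 1" for p :: "'a poly" and k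
  proof -
    have "pcompose p (Polynomial.monom 1 k) \<noteq> 0"
      using that pcompose_eq_0[of p "Polynomial.monom 1 k"] by (auto simp: degree_monom_eq)
    hence "finite {u. poly (pcompose p (Polynomial.monom 1 k)) u = 0}"
      by (rule poly_roots_finite)
    thus ?thesis by (simp add: poly_pcompose poly_monom)
  qed
  have "finite ({0} \<union> (\<Union>k\<in>{1..n}. {u. poly p (u ^ k) = 0} \<union> {u. poly q (u ^ k) = 0}))"
    using fin assms by auto
  from ex_new_if_finite[OF infinite_UNIV_char_0 this] show ?thesis by auto
qed

text \<open>The exponents 1, 2, 4 record in binary which of the letters 1, 2, 3 stand to the left of
  the letter 0. The entry of \<open>X\<close> at \<open>(i, j)\<close> is multiplied by the sum of
  \<open>c_k * v i ^ k * v j ^ (7 - k)\<close>, where \<open>c_k\<close> collects the words whose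
  set of left letters has code \<open>k\<close>. The hypothesis says that \<open>c1\<close> or
  \<open>c3\<close> is nonzero.\<close>

lemma img4_hollow_of_diagonal_subst:
  fixes A :: "'a::field_char_0^'n^'n::finite" and \<alpha> :: "(nat \<Rightarrow> nat) \<Rightarrow> 'a"
  assumes "\<alpha> (perm4 1 0 2 3) + \<alpha> (perm4 1 0 3 2) \<noteq> 0 \<or> \<alpha> (perm4 1 2 0 3) + \<alpha> (perm4 2 1 0 3) \<noteq> 0"
    and hollow: "\<And>i. A $ i $ i = 0"
  shows "A \<in> img4 \<alpha>"
proof -
  define c0 where "c0 = \<alpha> (perm4 0 1 2 3) + \<alpha> (perm4 0 1 3 2) + \<alpha> (perm4 0 2 1 3) + \<alpha> (perm4 0 2 3 1)
    + \<alpha> (perm4 0 3 1 2) + \<alpha> (perm4 0 3 2 1)"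
  define c1 where "c1 = \<alpha> (perm4 1 0 2 3) + \<alpha> (perm4 1 0 3 2)"
  define c2 where "c2 = \<alpha> (perm4 2 0 1 3) + \<alpha> (perm4 2 0 3 1)"
  define c3 where "c3 = \<alpha> (perm4 1 2 0 3) + \<alpha> (perm4 2 1 0 3)"
  define c4 where "c4 = \<alpha> (perm4 3 0 1 2) + \<alpha> (perm4 3 0 2 1)"
  define c5 where "c5 = \<alpha> (perm4 1 3 0 2) + \<alpha> (perm4 3 1 0 2)"
  define c6 where "c6 = \<alpha> (perm4 2 3 0 1) + \<alpha> (perm4 3 2 0 1)"
  define c7 where "c7 = \<alpha> (perm4 1 2 3 0) + \<alpha> (perm4 1 3 2 0) + \<alpha> (perm4 2 1 3 0) + \<alpha> (perm4 2 3 1 0)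
    + \<alpha> (perm4 3 1 2 0) + \<alpha> (perm4 3 2 1 0)"
  define C where "C = [:c0, c1, c2, c3, c4, c5, c6, c7:]"
  \<comment> \<open>\<open>\<Phi>\<close> is homogeneous of degree 7, so only the ratio of its
    arguments matters: \<open>C\<close> serves the entries below the diagonal, the reversed
    polynomial \<open>C'\<close> those above.\<close>
  define C' where "C' = [:c7, c6, c5, c4, c3, c2, c1, c0:]"
  define \<Phi> where "\<Phi> = (\<lambda>p q. c0 * q^7 + c1 * p * q^6 + c2 * p^2 * q^5 + c3 * p^3 * q^4 + c4 * p^4 * q^3
     + c5 * p^5 * q^2 + c6 * p^6 * q + c7 * p^7)"
  have "C \<noteq> 0" "C' \<noteq> 0"
    using assms(1) by (auto simp: C_def C'_def c1_def c3_def)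
  then obtain u where u: "u \<noteq> 0" "\<And>k. k \<in> {1..CARD('n)} \<Longrightarrow> poly C (u ^ k) \<noteq> 0 \<and> poly C' (u ^ k) \<noteq> 0"
    using exists_power_nonroot[of C C' "CARD('n)"] by blast
  have PhiC: "\<Phi> (w * q) q = q^7 * poly C w" "\<Phi> q (w * q) = q^7 * poly C' w" for w q
    unfolding \<Phi>_def C_def C'_def by (simp_all add: algebra_simps power_numeral_reduce)
  define v where "v = (\<lambda>i::int. u ^ nat i)"
  have nz: "\<Phi> (v i) (v j) \<noteq> 0" if "0 \<le> i" "0 \<le> j" "i < int CARD('n)" "j < int CARD('n)" "i \<noteq> j" for i j
  proof (cases "i < j")
    case True
    have "v j = u ^ nat (j - i) * v i"
      using True that by (simp add: v_def flip: power_add nat_add_distrib)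
    moreover have "nat (j - i) \<in> {1..CARD('n)}"
      using True that by auto
    ultimately show ?thesis
      using u(2)[of "nat (j - i)"] u(1) True that by (auto simp: PhiC(2) v_def)
  next
    case False
    have "v i = u ^ nat (i - j) * v j"
      using False that by (simp add: v_def flip: power_add nat_add_distrib)
    moreover have "nat (i - j) \<in> {1..CARD('n)}"
      using False that by auto
    ultimately show ?thesis
      using u(2)[of "nat (i - j)"] u(1) False that by (auto simp: PhiC(1) v_def)
  qed
  obtain F where A: "A = fmat F" by (rule fmat_surj)
  define N where "N = int CARD('n)"
  define X where "X = (\<lambda>i j. if 0 \<le> i \<and> i < N \<and> 0 \<le> j \<and> j < N \<and> i \<noteq> j then F i j / \<Phi> (v i) (v j) else 0)"
  define a :: "nat \<Rightarrow> 'a^'n^'n" where "a = (\<lambda>k. if k = 0 then fmat X else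
     shm 0 (\<lambda>i. if k = 1 then v i else if k = 2 then v i ^ 2 else v i ^ 4))"
  have X: "X i j = 0" if "i \<ge> int CARD('n)" for i j using that by (simp add: X_def N_def)
  have X': "X i j = 0" if "j < 0" for i j using that by (simp add: X_def)
  have ev: "eval_multilin4 \<alpha> a $ x $ y = \<Phi> (v (idx x)) (v (idx y)) * X (idx x) (idx y)" for x y
  proof -
    have alg: "\<Phi> p q = c0 * (q * q^2 * q^4) + c1 * (p * (q^2 * q^4)) + c2 * (p^2 * (q * q^4)) + c3 * (p * p^2 * q^4)
      + c4 * (p^4 * (q * q^2)) + c5 * (p * p^4 * q^2) + c6 * (p^2 * p^4 * q) + c7 * (p * p^2 * p^4)" for p q
      unfolding \<Phi>_def by (simp flip: power_add power_Suc)
    show ?thesis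
      unfolding eval_multilin4_expand a_def mat_1_eq_shm alg
      by (simp add: shm_mult shm_fmat_shm[OF _ _ X X'] c0_def c1_def c2_def c3_def c4_def c5_def c6_def c7_def)
        (simp add: algebra_simps)
  qed
  have "eval_multilin4 \<alpha> a = A"
    unfolding Finite_Cartesian_Product.vec_eq_iff
  proof (intro allI)
    fix x y
    show "eval_multilin4 \<alpha> a $ x $ y = A $ x $ y"
    proof (cases "x = y")
      case True
      then show ?thesis using hollow by (simp add: ev X_def)
    next
      case False
      then show ?thesis using nz[of "idx x" "idx y"] idx_range[of x] idx_range[of y]
        by (simp add: ev X_def A N_def)
    qed
  qed
  thus ?thesis by (auto simp: img4_def)
qed

lemma img4_trace_zero_of_diagonal_subst:
  fixes A :: "'a::field_char_0^'n^'n::finite" and \<alpha> :: "(nat \<Rightarrow> nat) \<Rightarrow> 'a"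
  assumes "\<alpha> (perm4 1 0 2 3) + \<alpha> (perm4 1 0 3 2) \<noteq> 0 \<or> \<alpha> (perm4 1 2 0 3) + \<alpha> (perm4 2 1 0 3) \<noteq> 0"
    and "trace A = 0"
  shows "A \<in> img4 \<alpha>"
  using similar_hollow[OF assms(2)] img4_hollow_of_diagonal_subst[OF assms(1)] img4_similar by blast

section \<open>Reordering the eigenvalues of a Jordan form\<close>

lemma ex_bij_betw_mono:
  fixes A B :: "int set"
  assumes "finite A" "finite B" "card A = card B"
  shows "\<exists>f. bij_betw f A B \<and> (\<forall>x\<in>A. \<forall>y\<in>A. x < y \<longrightarrow> f x < f y)"
  using assms
proof (induction A arbitrary: B rule: finite_linorder_max_induct)
  case empty
  then show ?case by auto
next
  case (insert b A)
  have bA: "b \<notin> A" using insert.hyps by blast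
  have ne: "B \<noteq> {}" using insert.prems insert.hyps(1) bA by auto
  have "card A = card (B - {Max B})"
    using insert.prems insert.hyps(1) bA ne by simp
  then obtain f where f: "bij_betw f A (B - {Max B})" "\<forall>x\<in>A. \<forall>y\<in>A. x < y \<longrightarrow> f x < f y"
    using insert.IH[of "B - {Max B}"] insert.prems by auto
  define g where "g = (\<lambda>x. if x \<in> A then f x else Max B)"
  have "bij_betw g (A \<union> {b}) ((B - {Max B}) \<union> {Max B})"
    unfolding g_def by (rule bij_betw_disjoint_Un[OF f(1)]) (use bA in \<open>auto simp: bij_betw_def\<close>)
  moreover have "(B - {Max B}) \<union> {Max B} = B" using Max_in[OF insert.prems(1) ne] by blast
  moreover have "g x < g y" if xy: "x \<in> insert b A" "y \<in> insert b A" "x < y" for x y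
  proof -
    have "x \<in> A" using xy insert.hyps(2) by force
    hence fx: "f x \<in> B" "f x \<noteq> Max B" using f(1) by (auto simp: bij_betw_def)
    hence "f x < Max B" using insert.prems by (simp add: order_less_le)
    thus ?thesis using \<open>x \<in> A\<close> xy f(2) by (auto simp: g_def)
  qed
  ultimately show ?case by (intro exI[of _ g]) auto
qed

text \<open>A stable rearrangement: \<open>\<pi>\<close> prescribes which eigenvalue stands where,
  and indices of one eigenvalue keep their original order, so that entries linking them stay above
  the diagonal. It is assembled from increasing bijections, one for each eigenvalue.\<close>

lemma ex_stable_reindex:
  fixes t :: "int \<Rightarrow> 'a"
  assumes R: "finite (R :: int set)" and \<pi>: "bij_betw \<pi> R R"
  obtains h where "bij_betw h R R" "\<And>x. x \<in> R \<Longrightarrow> t (h x) = t (\<pi> x)"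
    "\<And>x y. x \<in> R \<Longrightarrow> y \<in> R \<Longrightarrow> t (h x) = t (h y) \<Longrightarrow> h x < h y \<Longrightarrow> x < y"
proof -
  define S where "S = (\<lambda>v. {x\<in>R. t (\<pi> x) = v})"
  define S' where "S' = (\<lambda>v. {x\<in>R. t x = v})"
  have "\<exists>f. bij_betw f (S v) (S' v) \<and> (\<forall>x\<in>S v. \<forall>y\<in>S v. x < y \<longrightarrow> f x < f y)" for v
  proof (rule ex_bij_betw_mono)
    have "bij_betw \<pi> (S v) (S' v)"
      using \<pi> unfolding S_def S'_def by (auto simp: bij_betw_def inj_on_def image_iff)
    thus "card (S v) = card (S' v)" by (rule bij_betw_same_card)
  qed (use R in \<open>auto simp: S_def S'_def\<close>)
  then obtain f where f: "\<And>v. bij_betw (f v) (S v) (S' v)" "\<And>v x y. x \<in> S v \<Longrightarrow> y \<in> S v \<Longrightarrow> x < y \<Longrightarrow> f v x < f v y"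
    by metis
  define h where "h = (\<lambda>x. f (t (\<pi> x)) x)"
  have hS: "h x \<in> S' (t (\<pi> x))" if "x \<in> R" for x
    using bij_betwE[OF f(1)[of "t (\<pi> x)"]] that by (auto simp: h_def S_def)
  hence th: "h x \<in> R" "t (h x) = t (\<pi> x)" if "x \<in> R" for x
    using that by (auto simp: S'_def)
  have mono: "h x < h y" if "x \<in> R" "y \<in> R" "t (h x) = t (h y)" "x < y" for x y
    using f(2)[of x "t (\<pi> x)" y] th that by (auto simp: h_def S_def)
  have inj: "inj_on h R"
  proof (rule inj_onI)
    fix x y assume xy: "x \<in> R" "y \<in> R" "h x = h y"
    show "x = y"
      using mono[of x y] mono[of y x] xy by (cases x y rule: linorder_cases) auto
  qed
  show ?thesis
  proof
    have "h ` R = R"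
      by (rule endo_inj_surj) (use R th inj in auto)
    thus "bij_betw h R R"
      using inj by (simp add: bij_betw_def)
    show "x < y" if "x \<in> R" "y \<in> R" "t (h x) = t (h y)" "h x < h y" for x y
      using mono[of y x] that by (cases x y rule: linorder_cases) auto
  qed (use th in auto)
qed

text \<open>Bidiagonality is given up because interleaving the eigenvalues destroys it; these two
  properties survive.\<close>

definition jordan_like :: "int \<Rightarrow> (int \<Rightarrow> 'a::zero) \<Rightarrow> (int \<Rightarrow> int \<Rightarrow> 'a) \<Rightarrow> bool" where
  "jordan_like N t F \<longleftrightarrow> (\<forall>i\<in>{0..<N}. F i i = t i) \<and>
     (\<forall>i\<in>{0..<N}. \<forall>j\<in>{0..<N}. i \<noteq> j \<longrightarrow> F i j \<noteq> 0 \<longrightarrow> i < j \<and> t i = t j)"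

lemma jordan_like_nonzeroD:
  assumes "jordan_like N t F" "i \<in> {0..<N}" "j \<in> {0..<N}" "F i j \<noteq> 0"
  shows "i \<le> j \<and> t i = t j"
proof (cases "i = j")
  case False
  with assms have "i < j \<and> t i = t j" unfolding jordan_like_def by blast
  thus ?thesis by simp
qed simp

lemma similar_jordan_like:
  fixes A :: "'a::alg_closed_field^'n^'n::finite"
  obtains t F where "jordan_like (int CARD('n)) t F" "similar A (fmat F)"
    "\<And>i j. j \<noteq> i \<Longrightarrow> j \<noteq> i + 1 \<Longrightarrow> F i j = 0"
proof -
  obtain t s where ts: "similar A (fmat (\<lambda>i j. if i = j then t i else if j = i + 1 then s i else 0))"
    "\<And>i. 0 \<le> i \<Longrightarrow> i < int CARD('n) \<Longrightarrow> s i = 0 \<or> s i = 1 \<and> t i = t (i + 1)"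
    using similar_fmat_bidiagonal by blast
  have "t i = t (i + 1)" if "0 \<le> i" "i < int CARD('n)" "s i \<noteq> 0" for i
    using ts(2)[of i] that by simp
  thus ?thesis
    by (intro that[of t, OF _ ts(1)]) (auto simp: jordan_like_def)
qed

lemma jordan_like_reorder:
  fixes F :: "int \<Rightarrow> int \<Rightarrow> 'a::semiring_1"
  assumes F: "jordan_like (int CARD('n)) t F"
    and \<pi>: "bij_betw \<pi> {0..<int CARD('n)} {0..<int CARD('n)}"
  obtains F' where "jordan_like (int CARD('n)) (t \<circ> \<pi>) F'" "similar (fmat F :: 'a^'n^'n::finite) (fmat F')"
proof -
  let ?R = "{0..<int CARD('n)}"
  obtain h where h: "bij_betw h ?R ?R" "\<And>x. x \<in> ?R \<Longrightarrow> t (h x) = t (\<pi> x)"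
    "\<And>x y. x \<in> ?R \<Longrightarrow> y \<in> ?R \<Longrightarrow> t (h x) = t (h y) \<Longrightarrow> h x < h y \<Longrightarrow> x < y"
    using ex_stable_reindex[OF _ \<pi>, of t] by auto
  have hr: "h x \<in> ?R" if "x \<in> ?R" for x using bij_betwE[OF h(1)] that by blast
  have hi: "h x \<noteq> h y" if "x \<in> ?R" "y \<in> ?R" "x \<noteq> y" for x y
    using h(1) that by (auto simp: bij_betw_def inj_on_def)
  have "jordan_like (int CARD('n)) (t \<circ> \<pi>) (\<lambda>i j. F (h i) (h j))"
    unfolding jordan_like_def
  proof (intro conjI ballI impI)
    fix i assume "i \<in> ?R"
    thus "F (h i) (h i) = (t \<circ> \<pi>) i" using F hr h(2) unfolding jordan_like_def by auto
  next
    fix i j assume ij: "i \<in> ?R" "j \<in> ?R" "i \<noteq> j" "F (h i) (h j) \<noteq> 0"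
    hence "h i < h j" "t (h i) = t (h j)" using F hr hi unfolding jordan_like_def by blast+
    thus "i < j" "(t \<circ> \<pi>) i = (t \<circ> \<pi>) j" using h ij by auto
  qed
  thus ?thesis using that similar_reindex[OF h(1)] by blast
qed

lemma bij_betw_extend:
  assumes R: "finite R" and P: "P \<subseteq> R" and f: "inj_on f P" "f ` P \<subseteq> R"
  obtains \<pi> where "bij_betw \<pi> R R" "\<And>x. x \<in> P \<Longrightarrow> \<pi> x = f x"
proof -
  have "card (R - P) = card (R - f ` P)"
    using assms by (simp add: card_Diff_subset finite_subset card_image)
  then obtain g where g: "bij_betw g (R - P) (R - f ` P)"
    using finite_same_card_bij[of "R - P" "R - f ` P"] R by auto
  have "bij_betw (\<lambda>x. if x \<in> P then f x else g x) (P \<union> (R - P)) (f ` P \<union> (R - f ` P))"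
    by (rule bij_betw_disjoint_Un[OF _ g]) (use f in \<open>auto simp: bij_betw_def\<close>)
  moreover have "P \<union> (R - P) = R" "f ` P \<union> (R - f ` P) = R" using P f by auto
  ultimately show ?thesis using that[of "\<lambda>x. if x \<in> P then f x else g x"] by auto
qed

lemma sum_zero_two_values:
  fixes t :: "'i \<Rightarrow> 'a::field_char_0"
  assumes "finite R" "(\<Sum>i\<in>R. t i) = 0" "i \<in> R" "t i \<noteq> 0"
  shows "\<exists>j\<in>R. t j \<noteq> 0 \<and> t j \<noteq> t i"
proof (rule ccontr)
  assume "\<not> ?thesis"
  hence "(\<Sum>k\<in>R. t k) = (\<Sum>k\<in>{k\<in>R. t k \<noteq> 0}. t i)"
    using assms(1) by (intro sum.mono_neutral_cong_right) auto
  hence "of_nat (card {k\<in>R. t k \<noteq> 0}) * t i = 0" using assms by simp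
  moreover have "card {k\<in>R. t k \<noteq> 0} \<noteq> 0" using assms by auto
  ultimately show False using assms by simp
qed

text \<open>Nonzero ends make two partial sums of the eigenvalues nonzero, as the commutator case
  \<open>q = - 1\<close> requires. Distinct last entries serve the final transvection for the
  standard polynomial. Together with the nonzero ends, the remaining conditions keep the functionals
  \<open>d j - d i + d (i + 1) - d (i + 2)\<close> in \<open>ex_generic_diagonal\<close> from being
  proportional to the list.\<close>

lemma ex_listing:
  fixes t :: "int \<Rightarrow> 'a::field_char_0"
  assumes n: "n \<ge> 3" and sum0: "(\<Sum>i\<in>{0..<n}. t i) = 0" and nz: "\<exists>i\<in>{0..<n}. t i \<noteq> 0"
  obtains \<pi> where "bij_betw \<pi> {0..<n} {0..<n}" "t (\<pi> 0) \<noteq> 0" "t (\<pi> (n - 1)) \<noteq> 0"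
    "t (\<pi> (n - 2)) \<noteq> t (\<pi> (n - 1))" "n = 3 \<Longrightarrow> t (\<pi> 0) \<noteq> t (\<pi> 2)"
    "n \<ge> 4 \<Longrightarrow> \<not> (t (\<pi> 1) = - t (\<pi> 0) \<and> t (\<pi> 2) = t (\<pi> 0) \<and> t (\<pi> (n - 1)) = - t (\<pi> 0)
        \<and> (n \<ge> 5 \<longrightarrow> t (\<pi> (n - 2)) = 0))"
proof -
  let ?R = "{0..<n}"
  obtain i where i: "i \<in> ?R" "t i \<noteq> 0" using nz by blast
  obtain j where j: "j \<in> ?R" "t j \<noteq> 0" "t j \<noteq> t i"
    using sum_zero_two_values[OF _ sum0 i] by auto
  have ij: "i \<noteq> j" using j by auto
  show ?thesis
  proof (cases "\<exists>k\<in>?R. k \<noteq> i \<and> k \<noteq> j \<and> t k \<noteq> 0")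
    case False
    \<comment> \<open>With only two nonzero eigenvalues, these go to the two ends and zeros fill the
      middle.\<close>
    obtain \<pi> where \<pi>0: "bij_betw \<pi> ?R ?R" "\<And>x. x \<in> {0, n - 1} \<Longrightarrow> \<pi> x = (if x = 0 then i else j)"
      by (rule bij_betw_extend[of ?R "{0, n - 1}" "\<lambda>x. if x = 0 then i else j"])
        (use n i(1) j(1) ij in \<open>auto simp: inj_on_def\<close>)
    have \<pi>: "bij_betw \<pi> ?R ?R" "\<pi> 0 = i" "\<pi> (n - 1) = j"
      using \<pi>0(1) \<pi>0(2)[of 0] \<pi>0(2)[of "n - 1"] n by auto
    have z: "t (\<pi> x) = 0" if "x \<in> ?R" "x \<noteq> 0" "x \<noteq> n - 1" for x
    proof -
      have "\<pi> x \<in> ?R" using bij_betwE[OF \<pi>(1)] that by blast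
      moreover have "\<pi> x \<noteq> \<pi> 0" "\<pi> x \<noteq> \<pi> (n - 1)"
        using \<pi>(1) that n unfolding bij_betw_def inj_on_def by auto
      ultimately show ?thesis using False \<pi> by auto
    qed
    show ?thesis
      by (rule that[OF \<pi>(1)]) (use \<pi> i j z[of 1] z[of "n - 2"] n in auto)
  next
    case True
    then obtain k where k: "k \<in> ?R" "k \<noteq> i" "k \<noteq> j" "t k \<noteq> 0" by blast
    obtain a b c where abc: "a \<in> ?R" "b \<in> ?R" "c \<in> ?R" "a \<noteq> b" "a \<noteq> c" "b \<noteq> c"
      "t a \<noteq> 0" "t b \<noteq> 0" "t c \<noteq> 0" "t a \<noteq> t c" "t b \<noteq> t c"
    proof (cases "t k = t j")
      case True
      then show ?thesis using that[of j k i] i j k ij by auto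
    next
      case False
      then show ?thesis using that[of i k j] i j k ij by auto
    qed
    \<comment> \<open>A nonzero value at \<open>n - 2\<close> already excludes the forbidden pattern
      for \<open>n \<ge> 5\<close>; only \<open>n = 4\<close> needs care.\<close>
    obtain \<pi> where \<pi>0: "bij_betw \<pi> ?R ?R"
      "\<And>x. x \<in> {0, n - 2, n - 1} \<Longrightarrow> \<pi> x = (if x = 0 then a else if x = n - 2 then b else c)"
      by (rule bij_betw_extend[of ?R "{0, n - 2, n - 1}" "\<lambda>x. if x = 0 then a else if x = n - 2 then b else c"])
        (use n abc(1-6) in \<open>auto simp: inj_on_def\<close>)
    have \<pi>: "bij_betw \<pi> ?R ?R" "\<pi> 0 = a" "\<pi> (n - 2) = b" "\<pi> (n - 1) = c"
      using \<pi>0(1) \<pi>0(2)[of 0] \<pi>0(2)[of "n - 2"] \<pi>0(2)[of "n - 1"] n by auto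
    show ?thesis
    proof (cases "n = 4 \<and> t (\<pi> 1) = - t (\<pi> 0) \<and> t (\<pi> 2) = t (\<pi> 0) \<and> t (\<pi> 3) = - t (\<pi> 0)")
      case False
      show ?thesis
      proof (rule that[OF \<pi>(1)])
        show "\<not> (t (\<pi> 1) = - t (\<pi> 0) \<and> t (\<pi> 2) = t (\<pi> 0) \<and> t (\<pi> (n - 1)) = - t (\<pi> 0)
          \<and> (n \<ge> 5 \<longrightarrow> t (\<pi> (n - 2)) = 0))" if "n \<ge> 4"
          using False \<pi>(3) abc(8) that by (cases "n = 4") auto
      qed (use \<pi> abc in auto)
    next
      case True
      \<comment> \<open>The forbidden list is \<open>a, -a, a, -a\<close>; exchanging its first two
        entries gives the admissible \<open>-a, a, a, -a\<close>.\<close>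
      define \<pi>' where "\<pi>' = \<pi> \<circ> (\<lambda>x. if x = 0 then 1 else if x = 1 then 0 else x)"
      have "bij_betw (\<lambda>x. if x = 0 then 1 else if x = 1 then 0 else x) ?R ?R"
        by (rule bij_betwI[of _ _ _ "\<lambda>x. if x = 0 then 1 else if x = 1 then 0 else x"]) (use n in auto)
      hence b: "bij_betw \<pi>' ?R ?R" unfolding \<pi>'_def using bij_betw_trans \<pi>(1) by blast
      have v: "t (\<pi>' 0) = - t a" "t (\<pi>' 1) = t a" "t (\<pi>' 2) = t a" "t (\<pi>' 3) = - t a"
        using True \<pi> by (auto simp: \<pi>'_def)
      show ?thesis
        by (rule that[OF b]) (use v True abc in auto)
    qed
  qed
qed

lemma similar_jordan_like_listed:
  fixes A :: "'a::{alg_closed_field, field_char_0}^'n^'n::finite"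
  assumes n: "CARD('n) \<ge> 3" and tr: "trace A = 0"
  defines "N \<equiv> int CARD('n)"
  obtains (nilpotent) t F where "similar A (fmat F)" "jordan_like N t F" "\<And>i. i \<in> {0..<N} \<Longrightarrow> t i = 0"
      "\<And>i j. j \<noteq> i \<Longrightarrow> j \<noteq> i + 1 \<Longrightarrow> F i j = 0"
  | (listed) t F where "similar A (fmat F)" "jordan_like N t F" "(\<Sum>i\<in>{0..<N}. t i) = 0"
      "t 0 \<noteq> 0" "t (N - 1) \<noteq> 0" "t (N - 2) \<noteq> t (N - 1)" "N = 3 \<Longrightarrow> t 0 \<noteq> t 2"
      "N \<ge> 4 \<Longrightarrow> \<not> (t 1 = - t 0 \<and> t 2 = t 0 \<and> t (N - 1) = - t 0 \<and> (N \<ge> 5 \<longrightarrow> t (N - 2) = 0))"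
proof -
  obtain t F where tF: "jordan_like N t F" "similar A (fmat F)" "\<And>i j. j \<noteq> i \<Longrightarrow> j \<noteq> i + 1 \<Longrightarrow> F i j = 0"
    using similar_jordan_like[of A] unfolding N_def by blast
  have "trace (fmat F :: 'a^'n^'n) = (\<Sum>i\<in>{0..<N}. t i)"
    unfolding trace_fmat N_def using tF(1) by (intro sum.cong) (auto simp: jordan_like_def N_def)
  hence sum0: "(\<Sum>i\<in>{0..<N}. t i) = 0"
    using similar_trace[OF tF(2)] tr by simp
  have N3: "N \<ge> 3" using n by (simp add: N_def)
  show ?thesis
  proof (cases "\<exists>i\<in>{0..<N}. t i \<noteq> 0")
    case False
    then show ?thesis using nilpotent[OF tF(2,1)] tF(3) by blast
  next
    case True
    obtain \<pi> where \<pi>: "bij_betw \<pi> {0..<N} {0..<N}" "t (\<pi> 0) \<noteq> 0" "t (\<pi> (N - 1)) \<noteq> 0"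
    "t (\<pi> (N - 2)) \<noteq> t (\<pi> (N - 1))" "N = 3 \<Longrightarrow> t (\<pi> 0) \<noteq> t (\<pi> 2)"
    "N \<ge> 4 \<Longrightarrow> \<not> (t (\<pi> 1) = - t (\<pi> 0) \<and> t (\<pi> 2) = t (\<pi> 0) \<and> t (\<pi> (N - 1)) = - t (\<pi> 0)
        \<and> (N \<ge> 5 \<longrightarrow> t (\<pi> (N - 2)) = 0))"
      using ex_listing[OF N3 sum0 True] by blast
    obtain F' where F': "jordan_like N (t \<circ> \<pi>) F'" "similar (fmat F :: 'a^'n^'n) (fmat F')"
      using jordan_like_reorder[OF tF(1)[unfolded N_def] \<pi>(1)[unfolded N_def]] unfolding N_def by blast
    have "(\<Sum>i\<in>{0..<N}. (t \<circ> \<pi>) i) = 0"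
      using sum.reindex_bij_betw[OF \<pi>(1), of t] sum0 by simp
    with F' \<pi> show ?thesis
      by (intro listed[OF similar_trans[OF tF(2) F'(2)] F'(1)]) auto
  qed
qed

section \<open>Products of commutators with the shift\<close>

definition antisym_ends :: "((nat \<Rightarrow> nat) \<Rightarrow> 'a::comm_ring_1) \<Rightarrow> bool" where
  "antisym_ends \<alpha> \<longleftrightarrow> (\<forall>a b c d. {a, b, c, d} \<subseteq> {0..<4} \<longrightarrow> distinct [a, b, c, d] \<longrightarrow>
     \<alpha> (perm4 b a c d) = - \<alpha> (perm4 a b c d) \<and> \<alpha> (perm4 a b d c) = - \<alpha> (perm4 a b c d))"

text \<open>With antisymmetric ends \<open>f\<close> is a combination of products of two
  commutators. As the letters 1 and 2 both become \<open>D\<close>, the pairing that contains their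
  commutator disappears, and the other two pairings merge into \<open>U ** V\<close> and
  \<open>V ** U\<close>.\<close>

lemma img4_commutator_products:
  fixes X D Y :: "'a::field^'n^'n::finite"
  assumes anti: "antisym_ends \<alpha>"
  defines "p \<equiv> \<alpha> (perm4 0 1 2 3) + \<alpha> (perm4 0 2 1 3)"
    and "q \<equiv> \<alpha> (perm4 2 3 0 1) + \<alpha> (perm4 1 3 0 2)"
    and "U \<equiv> X ** D - D ** X" and "V \<equiv> D ** Y - Y ** D"
  shows "smat p (U ** V) + smat q (V ** U) \<in> img4 \<alpha>"
proof -
  define a where "a = (\<lambda>k::nat. if k = 0 then X else if k = 3 then Y else D)"
  have s1: "\<alpha> (perm4 b a c d) = - \<alpha> (perm4 a b c d)" if "{a, b, c, d} \<subseteq> {0..<4}" "distinct [a, b, c, d]" for a b c d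
    using anti that unfolding antisym_ends_def by blast
  have s2: "\<alpha> (perm4 a b d c) = - \<alpha> (perm4 a b c d)" if "{a, b, c, d} \<subseteq> {0..<4}" "distinct [a, b, c, d]" for a b c d
    using anti that unfolding antisym_ends_def by blast
  have A1: "\<alpha> (perm4 1 0 2 3) = - \<alpha> (perm4 0 1 2 3)" "\<alpha> (perm4 0 1 3 2) = - \<alpha> (perm4 0 1 2 3)" "\<alpha> (perm4 1 0 3 2) = \<alpha> (perm4 0 1 2 3)"
    using s1[of 0 1 2 3] s2[of 0 1 2 3] s2[of 1 0 2 3] by simp_all
  have A2: "\<alpha> (perm4 2 0 1 3) = - \<alpha> (perm4 0 2 1 3)" "\<alpha> (perm4 0 2 3 1) = - \<alpha> (perm4 0 2 1 3)" "\<alpha> (perm4 2 0 3 1) = \<alpha> (perm4 0 2 1 3)"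
    using s1[of 0 2 1 3] s2[of 0 2 1 3] s2[of 2 0 1 3] by simp_all
  have A3: "\<alpha> (perm4 3 0 1 2) = - \<alpha> (perm4 0 3 1 2)" "\<alpha> (perm4 0 3 2 1) = - \<alpha> (perm4 0 3 1 2)" "\<alpha> (perm4 3 0 2 1) = \<alpha> (perm4 0 3 1 2)"
    using s1[of 0 3 1 2] s2[of 0 3 1 2] s2[of 3 0 1 2] by simp_all
  have A4: "\<alpha> (perm4 2 1 0 3) = - \<alpha> (perm4 1 2 0 3)" "\<alpha> (perm4 1 2 3 0) = - \<alpha> (perm4 1 2 0 3)" "\<alpha> (perm4 2 1 3 0) = \<alpha> (perm4 1 2 0 3)"
    using s1[of 1 2 0 3] s2[of 1 2 0 3] s2[of 2 1 0 3] by simp_all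
  have A5: "\<alpha> (perm4 3 1 0 2) = - \<alpha> (perm4 1 3 0 2)" "\<alpha> (perm4 1 3 2 0) = - \<alpha> (perm4 1 3 0 2)" "\<alpha> (perm4 3 1 2 0) = \<alpha> (perm4 1 3 0 2)"
    using s1[of 1 3 0 2] s2[of 1 3 0 2] s2[of 3 1 0 2] by simp_all
  have A6: "\<alpha> (perm4 3 2 0 1) = - \<alpha> (perm4 2 3 0 1)" "\<alpha> (perm4 2 3 1 0) = - \<alpha> (perm4 2 3 0 1)" "\<alpha> (perm4 3 2 1 0) = \<alpha> (perm4 2 3 0 1)"
    using s1[of 2 3 0 1] s2[of 2 3 0 1] s2[of 3 2 0 1] by simp_all
  have "eval_multilin4 \<alpha> a $ i $ j = (smat p (U ** V) + smat q (V ** U)) $ i $ j" for i j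
  proof -
    have UV: "U ** V = X ** D ** D ** Y - X ** D ** Y ** D - D ** X ** D ** Y + D ** X ** Y ** D"
      unfolding U_def V_def by (simp add: matrix_diff_ldistrib matrix_diff_rdistrib matrix_mul_assoc)
    have VU: "V ** U = D ** Y ** X ** D - D ** Y ** D ** X - Y ** D ** X ** D + Y ** D ** D ** X"
      unfolding U_def V_def by (simp add: matrix_diff_ldistrib matrix_diff_rdistrib matrix_mul_assoc)
    define m where "m = (\<lambda>(P :: 'a^'n^'n) (Q :: 'a^'n^'n) (R :: 'a^'n^'n) (S :: 'a^'n^'n). (P ** Q ** R ** S) $ i $ j)"
    have "eval_multilin4 \<alpha> a $ i $ j = (\<Sum>(b,c,d)\<in>{(1,2,3),(1,3,2),(2,1,3),(2,3,1),(3,1,2),(3,2,1)}.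
        \<alpha> (perm4 0 b c d) * m (a 0) (a b) (a c) (a d) + \<alpha> (perm4 b 0 c d) * m (a b) (a 0) (a c) (a d)
      + \<alpha> (perm4 b c 0 d) * m (a b) (a c) (a 0) (a d) + \<alpha> (perm4 b c d 0) * m (a b) (a c) (a d) (a 0))"
      unfolding eval_multilin4_expand m_def by (simp add: matrix_mul_assoc)
    also have "\<dots> = p * (m X D D Y - m X D Y D - m D X D Y + m D X Y D)
       + q * (m D Y X D - m D Y D X - m Y D X D + m Y D D X)"
      by (simp add: a_def A1 A2 A3 A4 A5 A6 p_def q_def algebra_simps del: One_nat_def)
    also have "\<dots> = (smat p (U ** V) + smat q (V ** U)) $ i $ j"
      by (simp add: UV VU m_def smat_def)
    finally show ?thesis .
  qed
  hence "eval_multilin4 \<alpha> a = smat p (U ** V) + smat q (V ** U)"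
    by (simp add: Finite_Cartesian_Product.vec_eq_iff)
  thus ?thesis unfolding img4_def by (metis rangeI)
qed

definition in_ad_shift :: "'a::comm_ring_1^'n^'n::finite \<Rightarrow> bool" where
  "in_ad_shift V \<longleftrightarrow> (\<exists>X. X ** shm 1 (\<lambda>_. 1) - shm 1 (\<lambda>_. 1) ** X = V)"

lemma img4_of_in_ad_shift:
  fixes U V :: "'a::field^'n^'n::finite"
  assumes anti: "antisym_ends \<alpha>"
    and p: "\<alpha> (perm4 0 1 2 3) + \<alpha> (perm4 0 2 1 3) \<noteq> 0"
    and UV: "in_ad_shift U" "in_ad_shift V"
  defines "q \<equiv> (\<alpha> (perm4 2 3 0 1) + \<alpha> (perm4 1 3 0 2)) / (\<alpha> (perm4 0 1 2 3) + \<alpha> (perm4 0 2 1 3))"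
  shows "U ** V + smat q (V ** U) \<in> img4 \<alpha>"
proof -
  let ?p = "\<alpha> (perm4 0 1 2 3) + \<alpha> (perm4 0 2 1 3)"
  let ?N = "shm 1 (\<lambda>_. 1) :: 'a^'n^'n"
  obtain X Y where X: "X ** ?N - ?N ** X = U" and Y: "Y ** ?N - ?N ** Y = V"
    using UV unfolding in_ad_shift_def by blast
  have "?N ** smat (- 1 / ?p) Y - smat (- 1 / ?p) Y ** ?N = smat (- 1 / ?p) (?N ** Y - Y ** ?N)"
    by (simp add: smat_mult_left smat_mult_right) (simp add: smat_def Finite_Cartesian_Product.vec_eq_iff diff_divide_distrib)
  also have "\<dots> = smat (1 / ?p) V"
    unfolding Y[symmetric] by (simp add: smat_def Finite_Cartesian_Product.vec_eq_iff diff_divide_distrib)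
  finally have V': "?N ** smat (- 1 / ?p) Y - smat (- 1 / ?p) Y ** ?N = smat (1 / ?p) V" .
  have "U ** V + smat q (V ** U) = smat ?p (U ** smat (1 / ?p) V)
     + smat (\<alpha> (perm4 2 3 0 1) + \<alpha> (perm4 1 3 0 2)) (smat (1 / ?p) V ** U)"
    using p by (simp add: smat_mult_left smat_mult_right q_def)
      (simp add: smat_def Finite_Cartesian_Product.vec_eq_iff)
  thus ?thesis
    using img4_commutator_products[OF anti, of X ?N "smat (- 1 / ?p) Y"] X V' by simp
qed

lemma in_range_sum_shift:
  fixes V :: "int \<Rightarrow> int \<Rightarrow> 'a::ab_group_add" and n :: nat
  assumes V: "\<And>i j. i < 0 \<Longrightarrow> V i j = 0"
    and i: "i < int n"
  shows "(\<Sum>k<n. V (i - int k) (j - int k)) - (\<Sum>k<n. V (i - 1 - int k) (j - 1 - int k)) = V i j"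
proof -
  have "(\<Sum>k<n. V (i - int k) (j - int k)) - (\<Sum>k<n. V (i - 1 - int k) (j - 1 - int k))
      = (\<Sum>k<n. V (i - int k) (j - int k) - V (i - int (Suc k)) (j - int (Suc k)))"
    by (simp add: sum_subtractf algebra_simps)
  also have "\<dots> = V i j - V (i - int n) (j - int n)"
    using sum_lessThan_telescope'[of "\<lambda>k. V (i - int k) (j - int k)" n] by simp
  finally show ?thesis using V[of "i - int n"] i by simp
qed

text \<open>Sum of \<open>V\<close> along its diagonal through \<open>(i - 1, j)\<close>, from there
  up and to the left. For the plain shift \<open>N\<close> this is the recursive solution
  \<open>Z\<close> of \<open>N ** Z - Z ** N = V\<close>. At \<open>i = n\<close> the whole diagonal
  ending at \<open>(n - 1, j)\<close> is summed, which measures the obstruction.\<close>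

definition diag_sum :: "nat \<Rightarrow> (int \<Rightarrow> int \<Rightarrow> 'a::comm_ring_1) \<Rightarrow> int \<Rightarrow> int \<Rightarrow> 'a" where
  "diag_sum n V i j = (\<Sum>k<n. if 0 \<le> i - 1 - int k \<and> i - 1 - int k < int n \<and> 0 \<le> j - int k \<and> j - int k < int n
     then V (i - 1 - int k) (j - int k) else 0)"

lemma diag_sum_diff:
  assumes "0 \<le> i" "i < int n" "0 \<le> j" "j < int n"
  shows "diag_sum n V (i + 1) j - diag_sum n V i (j - 1) = V i j"
proof -
  define W where "W = (\<lambda>i j. if 0 \<le> i \<and> i < int n \<and> 0 \<le> j \<and> j < int n then V i j else 0)"
  have e: "i + 1 - 1 - int k = i - int k" for k by simp
  have "diag_sum n V (i + 1) j = (\<Sum>k<n. W (i - int k) (j - int k))"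
    "diag_sum n V i (j - 1) = (\<Sum>k<n. W (i - 1 - int k) (j - 1 - int k))"
    unfolding diag_sum_def W_def e by simp_all
  thus ?thesis
    using in_range_sum_shift[of W i n j] assms by (simp add: W_def)
qed

lemma diag_sum_neg: "j < 0 \<Longrightarrow> diag_sum n V i j = 0"
  by (simp add: diag_sum_def)

lemma diag_sum_lower:
  assumes "\<And>i j. 0 \<le> i \<Longrightarrow> i < int n \<Longrightarrow> 0 \<le> j \<Longrightarrow> j < int n \<Longrightarrow> j - i = d \<Longrightarrow> V i j = 0"
    and "j - i = d - 1"
  shows "diag_sum n V i j = 0"
  unfolding diag_sum_def by (rule sum.neutral) (use assms in auto)

lemma diag_sum_diagonal:
  assumes "0 \<le> i" "i \<le> int n"
  shows "diag_sum n V i (i - 1) = (\<Sum>k\<in>{0..<i}. V k k)"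
proof -
  have "diag_sum n V i (i - 1) = (\<Sum>k\<in>{..<nat i}. V (i - 1 - int k) (i - 1 - int k))"
    unfolding diag_sum_def using assms by (intro sum.mono_neutral_cong_right) (auto simp: nat_less_iff)
  also have "\<dots> = (\<Sum>k\<in>{0..<i}. V k k)"
    by (rule sum.reindex_bij_witness[of _ "\<lambda>k. nat (i - 1 - k)" "\<lambda>k. i - 1 - int k"]) auto
  finally show ?thesis .
qed

text \<open>In the last row the product with the shift on the left contributes nothing, so the
  recursive solution must reach zero there. The hypothesis thus says that the sums along the main
  diagonal and all subdiagonals vanish.\<close>

lemma in_ad_shiftI:
  fixes V :: "int \<Rightarrow> int \<Rightarrow> 'a::comm_ring_1"
  assumes "\<And>j. 0 \<le> j \<Longrightarrow> j < int CARD('n) \<Longrightarrow> diag_sum CARD('n) V (int CARD('n)) j = 0"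
  shows "in_ad_shift (fmat V :: 'a^'n^'n::finite)"
  unfolding in_ad_shift_def
proof
  let ?X = "fmat (\<lambda>i j. - diag_sum CARD('n) V i j) :: 'a^'n^'n"
  have "(?X ** shm 1 (\<lambda>_. 1) - shm 1 (\<lambda>_. 1) ** ?X) $ a $ b = fmat V $ a $ b" for a b :: 'n
  proof -
    have r: "0 \<le> idx a" "idx a < int CARD('n)" "0 \<le> idx b" "idx b < int CARD('n)"
      by (simp_all add: idx_range)
    have "(?X ** shm 1 (\<lambda>_. 1)) $ a $ b = - diag_sum CARD('n) V (idx a) (idx b - 1)"
      using diag_sum_neg[of "idx b - 1" "CARD('n)" V "idx a"] by (simp add: fmat_mult_shm)
    moreover have "(shm 1 (\<lambda>_. 1) ** ?X) $ a $ b = - diag_sum CARD('n) V (idx a + 1) (idx b)"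
    proof (cases "idx a + 1 < int CARD('n)")
      case False
      hence "idx a + 1 = int CARD('n)" using r(2) by simp
      thus ?thesis using assms[OF r(3,4)] by (simp add: shm_mult_fmat)
    qed (simp add: shm_mult_fmat)
    ultimately show ?thesis
      using diag_sum_diff[OF r, of V] by simp
  qed
  thus "?X ** shm 1 (\<lambda>_. 1) - shm 1 (\<lambda>_. 1) ** ?X = fmat V"
    by (simp add: Finite_Cartesian_Product.vec_eq_iff)
qed

lemma in_ad_shift_upper:
  fixes V :: "int \<Rightarrow> int \<Rightarrow> 'a::comm_ring_1"
  assumes "\<And>i j. 0 \<le> i \<Longrightarrow> i < int CARD('n) \<Longrightarrow> 0 \<le> j \<Longrightarrow> j < i \<Longrightarrow> V i j = 0"
    and "(\<Sum>i\<in>{0..<int CARD('n)}. V i i) = 0"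
  shows "in_ad_shift (fmat V :: 'a^'n^'n::finite)"
proof (rule in_ad_shiftI)
  fix j assume j: "0 \<le> j" "j < int CARD('n)"
  show "diag_sum CARD('n) V (int CARD('n)) j = 0"
  proof (cases "j = int CARD('n) - 1")
    case True
    then show ?thesis
      using diag_sum_diagonal[of "int CARD('n)" "CARD('n)" V] assms(2) by simp
  next
    case False
    then show ?thesis
      using j assms(1) by (intro diag_sum_lower[where d = "j - int CARD('n) + 1"]) auto
  qed
qed

section \<open>Triangular matrices as commutators, for \<open>q = - 1\<close>\<close>

text \<open>The weight at \<open>k\<close> is solved for, and the weight \<open>x\<close> at
  \<open>l\<close> is chosen so that the solution is nonzero. A single nonzero coefficient would
  force its own weight to be zero, hence the hypothesis.\<close>

lemma ex_nonzero_weights: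
  fixes z :: "'i \<Rightarrow> 'a::field_char_0"
  assumes S: "finite S" and z: "(\<forall>i\<in>S. z i = 0) \<or> (\<exists>i\<in>S. \<exists>j\<in>S. i \<noteq> j \<and> z i \<noteq> 0 \<and> z j \<noteq> 0)"
  obtains v where "\<And>i. v i \<noteq> 0" "(\<Sum>i\<in>S. z i * v i) = 0"
proof (cases "\<forall>i\<in>S. z i = 0")
  case True
  then show ?thesis using that[of "\<lambda>_. 1"] by simp
next
  case False
  then obtain k l where kl: "k \<in> S" "l \<in> S" "k \<noteq> l" "z k \<noteq> 0" "z l \<noteq> 0" using z by blast
  define c where "c = (\<Sum>i\<in>S - {k, l}. z i)"
  obtain x where x: "x \<noteq> 0" "c + z l * x \<noteq> 0"
  proof -
    obtain x where "x \<notin> {0, - c / z l}"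
      using ex_new_if_finite[OF infinite_UNIV_char_0, of "{0, - c / z l}"] by auto
    moreover have "x = - c / z l" if "c + z l * x = 0"
    proof -
      have "x * z l = - c" using that by (metis add.commute eq_neg_iff_add_eq_0 mult.commute)
      thus ?thesis using nonzero_eq_divide_eq[OF kl(5)] by blast
    qed
    ultimately show ?thesis using that by auto
  qed
  define y where "y = c + z l * x"
  define v where "v = (\<lambda>i. if i = k then - y / z k else if i = l then x else 1)"
  have "(\<Sum>i\<in>S. z i * v i) = z k * v k + (z l * v l + (\<Sum>i\<in>S - {k} - {l}. z i * v i))"
    using S kl by (simp add: sum.remove[of S k] sum.remove[of "S - {k}" l])
  also have "(\<Sum>i\<in>S - {k} - {l}. z i * v i) = c"
    unfolding c_def by (rule sum.cong) (auto simp: v_def)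
  finally have "(\<Sum>i\<in>S. z i * v i) = 0" using kl by (simp add: v_def y_def)
  moreover have "v i \<noteq> 0" for i using x(1) x(2)[folded y_def] kl by (auto simp: v_def)
  ultimately show ?thesis using that by blast
qed

text \<open>Here \<open>U\<close> is a weighted shift and \<open>V\<close> has entries on and above the subdiagonal. The weights are free
  and serve to make the subdiagonal sum of \<open>V\<close> vanish.\<close>

lemma upper_eq_commutator:
  fixes F :: "int \<Rightarrow> int \<Rightarrow> 'a::field_char_0"
  assumes upper: "\<And>i j. 0 \<le> i \<Longrightarrow> i < int CARD('n) \<Longrightarrow> 0 \<le> j \<Longrightarrow> j < i \<Longrightarrow> F i j = 0"
    and tr: "(\<Sum>i\<in>{0..<int CARD('n)}. F i i) = 0"
    and z: "(\<forall>i\<in>{0..<int CARD('n) - 1}. z i = 0) \<or>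
      (\<exists>i\<in>{0..<int CARD('n) - 1}. \<exists>j\<in>{0..<int CARD('n) - 1}. i \<noteq> j \<and> z i \<noteq> 0 \<and> z j \<noteq> 0)"
    and z_def: "\<And>i. z i = (\<Sum>k\<in>{0..<i + 1}. F k k)"
  obtains U V :: "'a^'n^'n::finite" where "in_ad_shift U" "in_ad_shift V" "U ** V - V ** U = fmat F"
proof -
  let ?n = "CARD('n)" and ?N = "int CARD('n)"
  obtain v where v: "\<And>i. v i \<noteq> 0" and zv: "(\<Sum>i\<in>{0..<?N - 1}. z i * v i) = 0"
    using ex_nonzero_weights[OF _ z] by auto
  \<comment> \<open>Conjugation by the diagonal matrix of \<open>\<omega>\<close> relates the plain
    shift to \<open>U\<close>. \<open>F1\<close> is the target transported to the plain shift, where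
    \<open>diag_sum\<close> solves the equation, and \<open>W\<close> is that solution transported
    back.\<close>
  define \<omega> where "\<omega> = (\<lambda>i::int. \<Prod>k\<in>{0..<i}. inverse (v k))"
  have \<omega>0: "\<omega> i \<noteq> 0" for i using v by (simp add: \<omega>_def)
  have \<omega>S: "\<omega> (i + 1) = \<omega> i * inverse (v i)" if "0 \<le> i" for i
  proof -
    have "{0..<i + 1} = insert i {0..<i}" using that by auto
    thus ?thesis by (simp add: \<omega>_def mult.commute)
  qed
  define F1 where "F1 = (\<lambda>i j. F i j * \<omega> i / \<omega> j)"
  define W where "W = (\<lambda>i j. diag_sum ?n F1 i j * \<omega> j / \<omega> i)"
  \<comment> \<open>A scalar matrix commutes with \<open>U\<close>, so adding it corrects the trace
    of \<open>V\<close> and leaves the commutator unchanged.\<close>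
  define c where "c = - (\<Sum>i\<in>{0..<?N}. W i i) / of_nat ?n"
  define V where "V = (\<lambda>i j. W i j + (if i = j then c else 0))"
  define U :: "'a^'n^'n" where "U = shm 1 (\<lambda>i. inverse (v i))"
  have F1d: "F1 i i = F i i" for i using \<omega>0 by (simp add: F1_def)
  have U: "in_ad_shift U"
    unfolding U_def shm_def by (rule in_ad_shift_upper) auto
  have lower: "W i j = 0" if "0 \<le> i" "i \<le> ?N" "j < i - 1" for i j
  proof -
    have "diag_sum ?n F1 i j = 0"
      using that upper by (intro diag_sum_lower[where d = "j - i + 1"]) (auto simp: F1_def)
    thus ?thesis by (simp add: W_def)
  qed
  have V: "in_ad_shift (fmat V :: 'a^'n^'n)"
  proof (rule in_ad_shiftI)
    fix j assume j: "0 \<le> j" "j < ?N"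
    consider "j = ?N - 1" | "j = ?N - 2" | "j < ?N - 2" using j by linarith
    thus "diag_sum ?n V ?N j = 0"
    proof cases
      case 1
      have "(\<Sum>i\<in>{0..<?N}. V i i) = (\<Sum>i\<in>{0..<?N}. W i i) + of_nat ?n * c"
        by (simp add: V_def sum.distrib)
      hence "(\<Sum>i\<in>{0..<?N}. V i i) = 0"
        by (simp add: c_def)
      thus ?thesis using diag_sum_diagonal[of ?N ?n V] 1 by simp
    next
      \<comment> \<open>The first subdiagonal of \<open>V\<close> has the entries
        \<open>z i * v i\<close>, so the choice of \<open>v\<close> removes this
        obstruction.\<close>
      case 2
      have "diag_sum ?n V ?N j = (\<Sum>k<?n. if 0 \<le> ?N - 2 - int k then V (?N - 1 - int k) (?N - 2 - int k) else 0)"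
        unfolding diag_sum_def 2 by (intro sum.cong) (auto simp: algebra_simps)
      also have "\<dots> = (\<Sum>k<?n - 1. V (?N - 1 - int k) (?N - 2 - int k))"
        by (intro sum.mono_neutral_cong_right) auto
      also have "\<dots> = (\<Sum>i\<in>{0..<?N - 1}. V (i + 1) i)"
        by (rule sum.reindex_bij_witness[of _ "\<lambda>i. nat (?N - 2 - i)" "\<lambda>k. ?N - 2 - int k"]) (auto simp: algebra_simps)
      also have "\<dots> = (\<Sum>i\<in>{0..<?N - 1}. z i * v i)"
      proof (rule sum.cong[OF refl])
        fix i assume i: "i \<in> {0..<?N - 1}"
        have "diag_sum ?n F1 (i + 1) i = z i"
          using diag_sum_diagonal[of "i + 1" ?n F1] i by (simp add: z_def F1d)
        thus "V (i + 1) i = z i * v i"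
          using i \<omega>0 v by (simp add: V_def W_def \<omega>S) (simp add: divide_inverse)
      qed
      finally show ?thesis using zv by simp
    next
      case 3
      show ?thesis
        by (rule diag_sum_lower[where d = "j - ?N + 1"]) (use 3 lower in \<open>auto simp: V_def\<close>)
    qed
  qed
  have "(U ** fmat V - fmat V ** U) $ a $ b = fmat F $ a $ b" for a b
  proof -
    define i j where ij: "i = idx a" "j = idx b"
    have r: "0 \<le> i" "i < ?N" "0 \<le> j" "j < ?N"
      unfolding ij by (simp_all add: idx_range)
    have l: "(U ** fmat V) $ a $ b = inverse (v i) * V (i + 1) j"
    proof (cases "i + 1 < ?N")
      case False
      hence e: "i + 1 = ?N" using r by simp
      have "diag_sum ?n F1 ?N j = 0"
      proof (cases "j = ?N - 1")
        case True
        then show ?thesis using diag_sum_diagonal[of ?N ?n F1] tr by (simp add: F1d)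
      next
        case False
        then show ?thesis using lower[of ?N j] r \<omega>0 by (simp add: W_def)
      qed
      thus ?thesis using e r by (simp add: U_def shm_mult_fmat V_def W_def ij[symmetric])
    qed (simp add: U_def shm_mult_fmat ij[symmetric])
    have rr: "(fmat V ** U) $ a $ b = V i (j - 1) * inverse (v (j - 1))"
      using r by (cases "j = 0") (simp_all add: U_def fmat_mult_shm ij[symmetric] V_def W_def diag_sum_neg)
    have cc: "(if i + 1 = j then c else 0) * inverse (v i) = (if i = j - 1 then c else 0) * inverse (v (j - 1))"
      by auto
    have w1: "inverse (v i) * W (i + 1) j = diag_sum ?n F1 (i + 1) j * \<omega> j / \<omega> i"
      using \<omega>0 v r by (simp add: W_def \<omega>S)
    have w2: "W i (j - 1) * inverse (v (j - 1)) = diag_sum ?n F1 i (j - 1) * \<omega> j / \<omega> i"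
    proof (cases "j = 0")
      case False
      thus ?thesis using \<omega>S[of "j - 1"] r by (simp add: W_def)
    qed (simp add: W_def diag_sum_neg)
    have "inverse (v i) * V (i + 1) j - V i (j - 1) * inverse (v (j - 1))
       = inverse (v i) * W (i + 1) j - W i (j - 1) * inverse (v (j - 1))"
      using cc by (simp add: V_def algebra_simps)
    also have "\<dots> = (diag_sum ?n F1 (i + 1) j - diag_sum ?n F1 i (j - 1)) * \<omega> j / \<omega> i"
      unfolding w1 w2 by (simp add: algebra_simps diff_divide_distrib)
    also have "\<dots> = F i j"
      using diag_sum_diff[OF r, of F1] \<omega>0 by (simp add: F1_def)
    finally show ?thesis using l rr by (simp add: ij)
  qed
  hence "U ** fmat V - fmat V ** U = fmat F"
    by (simp add: Finite_Cartesian_Product.vec_eq_iff)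
  with U V show ?thesis by (rule that)
qed

section \<open>Diagonal first factor, for \<open>q\<close> different from \<open>- 1\<close>\<close>

text \<open>With \<open>X = h x\<close> and hence \<open>k y = - (\<rho> + X)\<close>, clearing
  denominators turns the second equation into \<open>poly Q X = 0\<close>. As \<open>\<nu>\<close>
  and \<open>\<mu>\<close> are nonzero, no root is \<open>0\<close> or \<open>- \<rho>\<close>, so
  both weights are nonzero.\<close>

lemma ex_two_weights:
  fixes \<nu> \<mu> :: "'a::{alg_closed_field, field_char_0}" and h k \<rho> :: nat
  assumes pos: "h > 0" "k > 0" "\<rho> > 0" and nz: "\<nu> \<noteq> 0" "\<mu> \<noteq> 0"
  obtains x y where "x \<noteq> 0" "y \<noteq> 0" "of_nat h * x + of_nat k * y + of_nat \<rho> = 0"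
    "of_nat h * (\<nu> / x) + of_nat k * (\<mu> / y) = of_nat h * \<nu> + of_nat k * \<mu>"
proof -
  define H K P where HKP: "H = (of_nat h :: 'a)" "K = (of_nat k :: 'a)" "P = (of_nat \<rho> :: 'a)"
  have HKP0: "H \<noteq> 0" "K \<noteq> 0" "P \<noteq> 0" "H + K \<noteq> 0"
    using pos by (auto simp: HKP simp flip: of_nat_add)
  define r where "r = - (H * \<nu> + K * \<mu>)"
  \<comment> \<open>If the leading coefficient \<open>r\<close> vanishes, the linear one equals
    \<open>- K * \<mu> * (H + K)\<close>, which is nonzero; so \<open>Q\<close> is never
    constant.\<close>
  define Q where "Q = [:H\<^sup>2 * \<nu> * P, H\<^sup>2 * \<nu> - K\<^sup>2 * \<mu> + r * P, r:]"
  have "H\<^sup>2 * \<nu> - K\<^sup>2 * \<mu> + r * P \<noteq> 0" if r0: "r = 0"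
  proof
    assume "H\<^sup>2 * \<nu> - K\<^sup>2 * \<mu> + r * P = 0"
    moreover have "H * \<nu> = - (K * \<mu>)"
      using r0 unfolding r_def by (metis neg_equal_0_iff_equal eq_neg_iff_add_eq_0)
    hence "H\<^sup>2 * \<nu> = - (H * K * \<mu>)"
      by (simp add: power2_eq_square mult.assoc)
    ultimately have "- (K * \<mu> * (H + K)) = 0"
      using r0 by (simp add: algebra_simps power2_eq_square)
    thus False using HKP0 nz by simp
  qed
  hence "degree Q > 0" by (auto simp: Q_def)
  then obtain X where "poly Q X = 0"
    using alg_closed_imp_poly_has_root by blast
  hence X: "H\<^sup>2 * \<nu> * (P + X) - K\<^sup>2 * \<mu> * X + r * X * (P + X) = 0"
    by (simp add: Q_def algebra_simps)
  have X0: "X \<noteq> 0" using X HKP0 nz by auto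
  have PX0: "P + X \<noteq> 0"
  proof
    assume e: "P + X = 0"
    hence "X = - P" by (simp add: add_eq_0_iff)
    thus False using X HKP0 nz by (simp add: e)
  qed
  define x y where xy: "x = X / H" "y = - (P + X) / K"
  show ?thesis
  proof (rule that[of x y])
    show "x \<noteq> 0" using X0 HKP0 by (simp add: xy)
    have "- (P + X) \<noteq> 0" using PX0 by (simp only: neg_equal_0_iff_equal not_False_eq_True)
    thus "y \<noteq> 0" using HKP0 unfolding xy by (simp only: divide_eq_0_iff) simp
    show "of_nat h * x + of_nat k * y + of_nat \<rho> = 0"
      using HKP0 by (simp add: xy flip: HKP)
    define W where "W = P + X"
    have W0: "W \<noteq> 0" using PX0 by (simp add: W_def)
    have "H * (\<nu> / x) = H\<^sup>2 * \<nu> / X" "K * (\<mu> / y) = - (K\<^sup>2 * \<mu> / W)"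
      using HKP0 X0 W0 unfolding xy W_def[symmetric] by (simp_all add: power2_eq_square)
    hence "(H * (\<nu> / x) + K * (\<mu> / y) + r) * (X * W) = H\<^sup>2 * \<nu> * W - K\<^sup>2 * \<mu> * X + r * X * W"
      using X0 W0 by (simp add: distrib_right left_diff_distrib)
    hence "(H * (\<nu> / x) + K * (\<mu> / y) + r) * (X * W) = 0" using X by (simp only: W_def)
    hence "H * (\<nu> / x) + K * (\<mu> / y) + r = 0" using X0 W0 by (simp only: mult_eq_0_iff) simp
    hence "H * (\<nu> / x) + K * (\<mu> / y) = - r" by (simp only: eq_neg_iff_add_eq_0)
    thus "of_nat h * (\<nu> / x) + of_nat k * (\<mu> / y) = of_nat h * \<nu> + of_nat k * \<mu>"
      by (simp only: r_def minus_minus HKP)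
  qed
qed

text \<open>The right side of the second equation is the share of \<open>S\<close> and
  \<open>G\<close> in the sum of \<open>t\<close>; reweighting therefore leaves the total at zero.
  \<open>S\<close> may be a proper part of its eigenvalue class, while \<open>G\<close> is a whole
  class.\<close>

lemma sum_three_weights:
  fixes t :: "int \<Rightarrow> 'a::field_char_0"
  assumes R: "finite R" "S \<subseteq> {i\<in>R. t i = \<nu>}" and sum0: "(\<Sum>i\<in>R. t i) = 0" and \<nu>\<mu>: "\<nu> \<noteq> \<mu>"
  defines "G \<equiv> {i\<in>R. t i = \<mu>}"
  assumes xy: "of_nat (card S) * x + of_nat (card G) * y + of_nat (card (R - S - G)) = 0"
    "of_nat (card S) * (\<nu> / x) + of_nat (card G) * (\<mu> / y) = of_nat (card S) * \<nu> + of_nat (card G) * \<mu>"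
  defines "u \<equiv> \<lambda>i. if i \<in> S then x else if i \<in> G then y else 1"
  shows "(\<Sum>i\<in>R. u i) = 0" "(\<Sum>i\<in>R. t i / u i) = 0"
proof -
  have split: "(\<Sum>i\<in>R. f i) = (\<Sum>i\<in>S. f i) + (\<Sum>i\<in>G. f i) + (\<Sum>i\<in>R - S - G. f i)" for f :: "int \<Rightarrow> 'a"
  proof -
    have "S \<subseteq> R" "G \<subseteq> R - S" using R \<nu>\<mu> by (auto simp: G_def)
    hence "(\<Sum>i\<in>R. f i) = (\<Sum>i\<in>R - S. f i) + (\<Sum>i\<in>S. f i)"
      "(\<Sum>i\<in>R - S. f i) = (\<Sum>i\<in>R - S - G. f i) + (\<Sum>i\<in>G. f i)"
      using R by (simp_all add: sum.subset_diff)
    thus ?thesis by simp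
  qed
  have GS: "i \<notin> S" if "i \<in> G" for i using that R \<nu>\<mu> by (auto simp: G_def)
  have uS: "(\<Sum>i\<in>S. f (u i) (t i)) = of_nat (card S) * f x \<nu>" for f :: "'a \<Rightarrow> 'a \<Rightarrow> 'a"
  proof -
    have "(\<Sum>i\<in>S. f (u i) (t i)) = (\<Sum>i\<in>S. f x \<nu>)"
      using R by (intro sum.cong) (auto simp: u_def)
    thus ?thesis by simp
  qed
  have uG: "(\<Sum>i\<in>G. f (u i) (t i)) = of_nat (card G) * f y \<mu>" for f :: "'a \<Rightarrow> 'a \<Rightarrow> 'a"
  proof -
    have "(\<Sum>i\<in>G. f (u i) (t i)) = (\<Sum>i\<in>G. f y \<mu>)"
      using GS by (intro sum.cong) (auto simp: u_def, simp add: G_def)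
    thus ?thesis by simp
  qed
  have uQ: "(\<Sum>i\<in>R - S - G. f (u i) (t i)) = (\<Sum>i\<in>R - S - G. f 1 (t i))" for f :: "'a \<Rightarrow> 'a \<Rightarrow> 'a"
    by (intro sum.cong) (auto simp: u_def)
  show "(\<Sum>i\<in>R. u i) = 0"
    unfolding split[of u] using uS[of "\<lambda>a b. a"] uG[of "\<lambda>a b. a"] uQ[of "\<lambda>a b. a"] xy(1) by simp
  have "of_nat (card S) * \<nu> + of_nat (card G) * \<mu> + (\<Sum>i\<in>R - S - G. t i) = 0"
    using sum0 unfolding split[of t] using uS[of "\<lambda>a b. b"] uG[of "\<lambda>a b. b"] by simp
  thus "(\<Sum>i\<in>R. t i / u i) = 0"
    unfolding split[of "\<lambda>i. t i / u i"]
    using uS[of "\<lambda>a b. b / a"] uG[of "\<lambda>a b. b / a"] uQ[of "\<lambda>a b. b / a"] xy(2) by simp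
qed

text \<open>\<open>u\<close> becomes the diagonal of \<open>U\<close>, and \<open>V\<close> has the
  entries \<open>F i j / (u i + q * u j)\<close>. The two sums are the traces of \<open>U\<close>
  and, up to the factor \<open>1 + q\<close>, of \<open>V\<close>; the last property permits the
  divisions. Weights constant on an eigenvalue class are harmless because
  \<open>1 + q \<noteq> 0\<close>; a deviating index is put first or last in its class.\<close>

lemma ex_balanced_weights:
  fixes t :: "int \<Rightarrow> 'a::{alg_closed_field, field_char_0}"
  assumes N: "N \<ge> 3" and sum0: "(\<Sum>i\<in>{0..<N}. t i) = 0" and q: "q \<noteq> - 1"
  obtains u where "\<And>i. i \<in> {0..<N} \<Longrightarrow> u i \<noteq> 0" "(\<Sum>i\<in>{0..<N}. u i) = 0" "(\<Sum>i\<in>{0..<N}. t i / u i) = 0"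
    "\<And>i j. i \<in> {0..<N} \<Longrightarrow> j \<in> {0..<N} \<Longrightarrow> i \<le> j \<Longrightarrow> t i = t j \<Longrightarrow> u i + q * u j \<noteq> 0"
proof (cases "\<forall>i\<in>{0..<N}. t i = 0")
  case True
  note balanced = that
  \<comment> \<open>All weights are \<open>1\<close> except \<open>- c\<close> at one index
    \<open>e\<close>. With \<open>e\<close> last only \<open>1 - q * c\<close> has to be nonzero,
    with \<open>e\<close> first only \<open>q - c\<close>; both vanish only if
    \<open>c * c = 1\<close>.\<close>
  define c where "c = (of_int (N - 1) :: 'a)"
  have c0: "c \<noteq> 0" using N by (simp only: c_def of_int_eq_0_iff)
  have c1: "c * c \<noteq> 1"
  proof
    assume "c * c = 1"
    hence "of_int ((N - 1) * (N - 1)) = (of_int 1 :: 'a)" by (simp only: c_def of_int_mult of_int_1)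
    hence e: "(N - 1) * (N - 1) = 1" by (simp only: of_int_eq_iff)
    have "(N - 1) * (N - 1) \<ge> 2 * 2" using N by (intro mult_mono) auto
    with e show False by simp
  qed
  have q1: "1 + q \<noteq> 0" using q by (metis add_eq_0_iff)
  have main: thesis if e: "e \<in> {0..<N}" and nz: "\<And>i j. i \<in> {0..<N} \<Longrightarrow> j \<in> {0..<N} \<Longrightarrow> i < j \<Longrightarrow>
      (if i = e then - c else 1) + q * (if j = e then - c else 1) \<noteq> 0" for e
  proof (rule balanced[of "\<lambda>i. if i = e then - c else 1"])
    have "(\<Sum>i\<in>{0..<N}. if i = e then - c else 1) = - c + (\<Sum>i\<in>{0..<N} - {e}. 1)"
      using e by (subst sum.remove[of _ e]) (auto intro!: sum.cong)
    also have "(\<Sum>i\<in>{0..<N} - {e}. 1) = c"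
      using e N by (simp add: c_def)
    finally show "(\<Sum>i\<in>{0..<N}. if i = e then - c else 1) = 0" by simp
    fix i j assume ij: "i \<in> {0..<N}" "j \<in> {0..<N}" "i \<le> j"
    show "(if i = e then - c else 1) + q * (if j = e then - c else 1) \<noteq> 0"
    proof (cases "i = j")
      case True
      have "- c + q * - c = - (c * (1 + q))" by (simp add: algebra_simps)
      then show ?thesis using True q1 c0 by auto
    next
      case False
      then show ?thesis using nz ij by auto
    qed
  qed (use True c0 in auto)
  show ?thesis
  proof (cases "1 + q * - c = 0")
    case False
    show ?thesis by (rule main[of "N - 1"]) (use N False q1 in auto)
  next
    case T: True
    have "- c + q \<noteq> 0"
    proof
      assume "- c + q = 0"
      hence "q = c" by simp
      thus False using T c1 by simp
    qed
    thus ?thesis by (intro main[of 0]) (use N q1 in auto)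
  qed
next
  case False
  note balanced = that
  let ?R = "{0..<N}"
  obtain i0 where i0: "i0 \<in> ?R" "t i0 \<noteq> 0" using False by blast
  obtain j0 where j0: "j0 \<in> ?R" "t j0 \<noteq> 0" "t j0 \<noteq> t i0"
    using sum_zero_two_values[OF _ sum0 i0] by auto
  have q1: "1 + q \<noteq> 0" using q by (metis add_eq_0_iff)
  have qq: "w + q * w \<noteq> 0" if "w \<noteq> 0" for w
    using that q1 by (metis distrib_right mult_1 mult_eq_0_iff)
  define G where "G = (\<lambda>v. {i\<in>?R. t i = v})"
  have Gv: "G v = {i\<in>?R. t i = v}" for v by (simp only: G_def)
  have finG: "finite (G v)" for v by (rule finite_subset[of _ ?R]) (auto simp: G_def)
  show ?thesis
  proof (cases "\<exists>k\<in>?R. t k \<noteq> t i0 \<and> t k \<noteq> t j0")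
    case True
    \<comment> \<open>With a third eigenvalue the weights \<open>x\<close>, \<open>y\<close>,
      \<open>1\<close> can be constant on eigenvalue classes.\<close>
    then obtain k where k: "k \<in> ?R" "t k \<noteq> t i0" "t k \<noteq> t j0" by blast
    have "i0 \<in> G (t i0)" "j0 \<in> G (t j0)" "k \<in> ?R - G (t i0) - G (t j0)"
      using i0 j0 k by (auto simp: G_def)
    hence c: "card (G (t i0)) > 0" "card (G (t j0)) > 0" "card (?R - G (t i0) - G (t j0)) > 0"
      using finG by (auto simp: card_gt_0_iff)
    obtain x y where xy: "x \<noteq> 0" "y \<noteq> 0"
      "of_nat (card (G (t i0))) * x + of_nat (card (G (t j0))) * y + of_nat (card (?R - G (t i0) - G (t j0))) = 0"
      "of_nat (card (G (t i0))) * (t i0 / x) + of_nat (card (G (t j0))) * (t j0 / y)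
        = of_nat (card (G (t i0))) * t i0 + of_nat (card (G (t j0))) * t j0"
      using ex_two_weights[OF c i0(2) j0(2)] by blast
    note sums = sum_three_weights[of ?R "G (t i0)" t "t i0" "t j0" x y, folded Gv,
        OF finite_atLeastLessThan_int subset_refl sum0 j0(3)[symmetric] xy(3,4)]
    show ?thesis
    proof (rule that[of "\<lambda>i. if i \<in> G (t i0) then x else if i \<in> G (t j0) then y else 1"])
      show "(\<Sum>i\<in>?R. if i \<in> G (t i0) then x else if i \<in> G (t j0) then y else 1) = 0"
        "(\<Sum>i\<in>?R. t i / (if i \<in> G (t i0) then x else if i \<in> G (t j0) then y else 1)) = 0"
        by (rule sums)+
    qed (use xy(1,2) q1 qq in \<open>auto simp: G_def\<close>)
  next
    case two: False
    \<comment> \<open>With two eigenvalues, weights constant on the classes fail: the equations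
      would make them equal, then zero. So one member of a class of size at least two receives a
      weight of its own.\<close>
    obtain a b where ab: "a \<in> ?R" "b \<in> ?R" "t a \<noteq> 0" "t b \<noteq> 0" "t a \<noteq> t b"
      and two': "\<forall>k\<in>?R. t k = t a \<or> t k = t b" and card2: "card (G (t a)) \<ge> 2"
    proof -
      have "?R = G (t i0) \<union> G (t j0)" "G (t i0) \<inter> G (t j0) = {}"
        using two j0(3) by (auto simp: G_def)
      hence "card ?R = card (G (t i0)) + card (G (t j0))"
        using finG by (metis card_Un_disjoint)
      hence "card (G (t i0)) \<ge> 2 \<or> card (G (t j0)) \<ge> 2" using N by auto
      thus ?thesis
        using that[of i0 j0] that[of j0 i0] two i0 j0 by metis
    qed
    define m k where mk: "m = card (G (t a))" "k = card (G (t b))"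
    have k0: "k > 0" using ab finG by (auto simp: mk card_gt_0_iff G_def)
    have m2: "m \<ge> 2" using card2 by (simp add: mk)
    have sum_mk: "of_nat m * t a + of_nat k * t b = 0"
    proof -
      have "?R = G (t a) \<union> G (t b)" "G (t a) \<inter> G (t b) = {}"
        using two' ab(5) by (auto simp: G_def)
      hence "(\<Sum>i\<in>?R. t i) = (\<Sum>i\<in>G (t a). t i) + (\<Sum>i\<in>G (t b). t i)"
        using finG by (metis sum.union_disjoint)
      moreover have "(\<Sum>i\<in>G v. t i) = of_nat (card (G v)) * v" for v
      proof -
        have "(\<Sum>i\<in>G v. t i) = (\<Sum>i\<in>G v. v)" by (rule sum.cong) (auto simp: G_def)
        thus ?thesis by simp
      qed
      ultimately show ?thesis using sum0 by (simp add: mk)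
    qed
    obtain x y where xy: "x \<noteq> 0" "y \<noteq> 0" "of_nat 1 * x + of_nat k * y + of_nat (m - 1) = 0"
      "of_nat 1 * (t a / x) + of_nat k * (t b / y) = of_nat 1 * t a + of_nat k * t b"
      using ex_two_weights[of 1 k "m - 1" "t a" "t b"] k0 m2 ab by auto
    \<comment> \<open>Both placements of the deviating index fail only for \<open>q = 1\<close> and
      \<open>x = - 1\<close>. Eliminating \<open>y\<close> and \<open>t b\<close>, the value
      \<open>x = - 1\<close> would give \<open>k * m + (m - 2)^2 = 0\<close>.\<close>
    have x1: "x \<noteq> - 1"
    proof
      assume x: "x = - 1"
      define M K where MK: "M = (of_nat m :: 'a)" "K = (of_nat k :: 'a)"
      have Ky: "K * y = 2 - M"
        using xy(3) m2 x by (simp add: MK of_nat_diff algebra_simps eq_neg_iff_add_eq_0)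
      have Kb: "K * t b = - (M * t a)"
        using sum_mk by (simp add: MK eq_neg_iff_add_eq_0 add.commute)
      have "K * (t b / y) = 2 * t a - M * t a"
        using xy(4) Kb x by (simp add: MK algebra_simps)
      hence "K * t b = (2 * t a - M * t a) * y"
        using xy(2) by (simp add: field_simps)
      hence "K * (K * t b) = K * ((2 * t a - M * t a) * y)" by (rule arg_cong)
      also have "\<dots> = (2 - M) * t a * (K * y)" by (simp add: algebra_simps)
      finally have "K * - (M * t a) = (2 - M) * t a * (2 - M)" by (simp only: Ky Kb)
      moreover have "(K * M + (2 - M) * (2 - M)) * t a = (2 - M) * t a * (2 - M) - K * - (M * t a)"
        by (simp add: algebra_simps)
      ultimately have "(K * M + (2 - M) * (2 - M)) * t a = 0" by simp
      hence "K * M + (2 - M) * (2 - M) = 0"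
        using ab(3) by (simp only: mult_eq_0_iff simp_thms)
      hence "K * M + (M - 2) * (M - 2) = 0"
        by (simp add: algebra_simps)
      moreover have "M - 2 = of_nat (m - 2)" using m2 by (simp add: MK of_nat_diff)
      ultimately have "of_nat (k * m + (m - 2) * (m - 2)) = (0 :: 'a)"
        by (simp only: MK of_nat_add of_nat_mult)
      hence "k * m = 0" by (simp only: of_nat_eq_0_iff add_is_0)
      thus False using k0 m2 by simp
    qed
    have main: thesis if e: "e \<in> G (t a)" and nz: "\<And>i. i \<in> G (t a) \<Longrightarrow> i \<noteq> e \<Longrightarrow>
       (i < e \<longrightarrow> 1 + q * x \<noteq> 0) \<and> (e < i \<longrightarrow> x + q \<noteq> 0)" for e
    proof -
      have Q: "?R - {e} - G (t b) = G (t a) - {e}"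
        using two' ab(5) e by (auto simp: G_def)
      have "card (?R - {e} - G (t b)) = m - 1"
        unfolding Q using e finG by (simp add: mk)
      hence cards: "of_nat (card {e}) * x + of_nat (card (G (t b))) * y + of_nat (card (?R - {e} - G (t b))) = 0"
        "of_nat (card {e}) * (t a / x) + of_nat (card (G (t b))) * (t b / y)
          = of_nat (card {e}) * t a + of_nat (card (G (t b))) * t b"
        using xy(3,4) by (simp_all add: mk)
      have "{e} \<subseteq> G (t a)" using e by simp
      note sums = sum_three_weights[of ?R "{e}" t "t a" "t b" x y, folded Gv,
        OF finite_atLeastLessThan_int this sum0 ab(5) cards]
      show ?thesis
      proof (rule balanced[OF _ sums])
        fix i j assume ij: "i \<in> ?R" "j \<in> ?R" "i \<le> j" "t i = t j"
        show "(if i \<in> {e} then x else if i \<in> G (t b) then y else 1) +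
          q * (if j \<in> {e} then x else if j \<in> G (t b) then y else 1) \<noteq> 0"
        proof (cases "t i = t a")
          case True
          hence g: "i \<in> G (t a)" "j \<in> G (t a)" "i \<notin> G (t b)" "j \<notin> G (t b)"
            using ij ab(5) by (auto simp: G_def)
          show ?thesis
            using nz[OF g(1)] nz[OF g(2)] qq[OF xy(1)] q1 g ij by auto
        next
          case False
          hence "i \<in> G (t b)" "j \<in> G (t b)" "i \<noteq> e" "j \<noteq> e"
            using two' ij e by (auto simp: G_def)
          thus ?thesis using qq[OF xy(2)] by simp
        qed
      qed (use xy in auto)
    qed
    have ne: "G (t a) \<noteq> {}" using ab by (auto simp: G_def)
    show ?thesis
    proof (cases "1 + q * x = 0")
      case False
      show ?thesis
      proof (rule main[OF Max_in[OF finG ne]])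
        fix i assume "i \<in> G (t a)" "i \<noteq> Max (G (t a))"
        hence "i < Max (G (t a))"
          using Max_ge[OF finG, of i "t a"] by linarith
        thus "(i < Max (G (t a)) \<longrightarrow> 1 + q * x \<noteq> 0) \<and> (Max (G (t a)) < i \<longrightarrow> x + q \<noteq> 0)"
          using False by linarith
      qed
    next
      case True
      have *: "x + q \<noteq> 0"
      proof
        assume "x + q = 0"
        hence "x = - q" by (simp add: eq_neg_iff_add_eq_0)
        hence "q * q = 1" using True by simp
        hence "(q - 1) * (q + 1) = 0" by (simp add: algebra_simps)
        hence "q = 1" using q1 by (simp add: add.commute)
        thus False using x1 \<open>x = - q\<close> by simp
      qed
      show ?thesis
      proof (rule main[OF Min_in[OF finG ne]])
        fix i assume "i \<in> G (t a)" "i \<noteq> Min (G (t a))"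
        hence "Min (G (t a)) < i"
          using Min_le[OF finG, of i "t a"] by linarith
        thus "(i < Min (G (t a)) \<longrightarrow> 1 + q * x \<noteq> 0) \<and> (Min (G (t a)) < i \<longrightarrow> x + q \<noteq> 0)"
          using * by linarith
      qed
    qed
  qed
qed

lemma img4_trace_zero_of_commutators:
  fixes A :: "'a::{alg_closed_field, field_char_0}^'n^'n::finite"
  assumes n: "CARD('n) \<ge> 3" and tr: "trace A = 0" and anti: "antisym_ends \<alpha>"
    and p: "\<alpha> (perm4 0 1 2 3) + \<alpha> (perm4 0 2 1 3) \<noteq> 0"
  shows "A \<in> img4 \<alpha>"
proof -
  let ?N = "int CARD('n)"
  define q where "q = (\<alpha> (perm4 2 3 0 1) + \<alpha> (perm4 1 3 0 2)) / (\<alpha> (perm4 0 1 2 3) + \<alpha> (perm4 0 2 1 3))"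
  note img = img4_of_in_ad_shift[OF anti p, folded q_def]
  obtain t F where F: "similar A (fmat F)" "jordan_like ?N t F" "(\<Sum>i\<in>{0..<?N}. t i) = 0"
    and t: "(\<forall>i\<in>{0..<?N}. t i = 0) \<or> t 0 \<noteq> 0 \<and> t (?N - 1) \<noteq> 0"
  proof (rule similar_jordan_like_listed[OF n tr])
    fix t F assume "similar A (fmat F)" "jordan_like ?N t F" "\<And>i. i \<in> {0..<?N} \<Longrightarrow> t i = 0"
    thus thesis by (intro that[of F t]) simp_all
  next
    fix t F assume "similar A (fmat F)" "jordan_like ?N t F" "(\<Sum>i\<in>{0..<?N}. t i) = 0"
      "t 0 \<noteq> 0" "t (?N - 1) \<noteq> 0"
    thus thesis by (intro that[of F t]) simp_all
  qed
  have Fd: "F i i = t i" if "i \<in> {0..<?N}" for i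
    using F(2) that by (auto simp: jordan_like_def)
  have Fu: "F i j = 0" if "0 \<le> i" "i < ?N" "0 \<le> j" "j < i" for i j
    using jordan_like_nonzeroD[OF F(2), of i j] that by force
  have Ft: "(\<Sum>i\<in>{0..<?N}. F i i) = 0" using Fd F(3) by simp
  obtain U V :: "'a^'n^'n" where UV: "in_ad_shift U" "in_ad_shift V" "U ** V + smat q (V ** U) = fmat F"
  proof (cases "q = - 1")
    case True
    define z where "z = (\<lambda>i. \<Sum>k\<in>{0..<i + 1}. F k k)"
    have z: "(\<forall>i\<in>{0..<?N - 1}. z i = 0) \<or> (\<exists>i\<in>{0..<?N - 1}. \<exists>j\<in>{0..<?N - 1}. i \<noteq> j \<and> z i \<noteq> 0 \<and> z j \<noteq> 0)"
      using t
    proof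
      assume "\<forall>i\<in>{0..<?N}. t i = 0"
      hence "z i = 0" if "i \<in> {0..<?N - 1}" for i
        unfolding z_def using that Fd by (intro sum.neutral) auto
      thus ?thesis by blast
    next
      assume t: "t 0 \<noteq> 0 \<and> t (?N - 1) \<noteq> 0"
      \<comment> \<open>The two nonzero partial sums are \<open>z 0 = t 0\<close> and
        \<open>z (N - 2) = - t (N - 1)\<close>; their indices differ because
        \<open>N \<ge> 3\<close>.\<close>
      have z0: "z 0 \<noteq> 0"
      proof -
        have "{0..<0 + 1} = {0::int}" by auto
        thus ?thesis using t Fd[of 0] n by (simp add: z_def)
      qed
      have "{0..<?N} = insert (?N - 1) {0..<?N - 2 + 1}" using n by auto
      hence "F (?N - 1) (?N - 1) + z (?N - 2) = 0"
        using Ft by (simp add: z_def)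
      hence "z (?N - 2) \<noteq> 0" using Fd[of "?N - 1"] n t by auto
      thus ?thesis using z0 n by (intro disjI2 bexI[of _ 0] bexI[of _ "?N - 2"]) auto
    qed
    obtain U V :: "'a^'n^'n" where "in_ad_shift U" "in_ad_shift V" "U ** V - V ** U = fmat F"
      by (rule upper_eq_commutator[where F = F and z = z and 'n = 'n, OF Fu Ft z fun_cong[OF z_def]])
    moreover have "U ** V + smat q (V ** U) = U ** V - V ** U"
      by (simp add: True smat_def Finite_Cartesian_Product.vec_eq_iff)
    ultimately show ?thesis by (intro that[of U V]) simp_all
  next
    case False
    have N3: "?N \<ge> 3" using n by simp
    obtain u where u: "\<And>i. i \<in> {0..<?N} \<Longrightarrow> u i \<noteq> 0" "(\<Sum>i\<in>{0..<?N}. u i) = 0" "(\<Sum>i\<in>{0..<?N}. t i / u i) = 0"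
      "\<And>i j. i \<in> {0..<?N} \<Longrightarrow> j \<in> {0..<?N} \<Longrightarrow> i \<le> j \<Longrightarrow> t i = t j \<Longrightarrow> u i + q * u j \<noteq> 0"
      using ex_balanced_weights[OF N3 F(3) False] by blast
    define V where "V = (\<lambda>i j. F i j / (u i + q * u j))"
    have "in_ad_shift (shm 0 u :: 'a^'n^'n)"
      unfolding shm_def by (rule in_ad_shift_upper) (use u(2) in auto)
    moreover have "in_ad_shift (fmat V :: 'a^'n^'n)"
    proof (rule in_ad_shift_upper)
      have q1: "1 + q \<noteq> 0" using False by (metis add_eq_0_iff)
      have "(\<Sum>i\<in>{0..<?N}. V i i) = (\<Sum>i\<in>{0..<?N}. t i / u i / (1 + q))"
      proof (rule sum.cong[OF refl])
        fix i assume i: "i \<in> {0..<?N}"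
        have "u i + q * u i = u i * (1 + q)" by (simp add: algebra_simps)
        thus "V i i = t i / u i / (1 + q)" using Fd[OF i] by (simp add: V_def)
      qed
      also have "\<dots> = (\<Sum>i\<in>{0..<?N}. t i / u i) / (1 + q)"
        by (rule sum_divide_distrib[symmetric])
      finally show "(\<Sum>i\<in>{0..<?N}. V i i) = 0" using u(3) by simp
    qed (use Fu in \<open>auto simp: V_def\<close>)
    moreover have "shm 0 u ** fmat V + smat q (fmat V ** shm 0 u) = (fmat F :: 'a^'n^'n)"
    proof -
      have "u i * V i j + q * (V i j * u j) = F i j" if ij: "i \<in> {0..<?N}" "j \<in> {0..<?N}" for i j
      proof (cases "F i j = 0")
        case True
        then show ?thesis by (simp add: V_def)
      next
        case False
        hence "i \<le> j" "t i = t j" using jordan_like_nonzeroD[OF F(2)] ij by blast+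
        hence "u i + q * u j \<noteq> 0" using u(4) ij by blast
        moreover have "u i * V i j + q * (V i j * u j) = V i j * (u i + q * u j)" by (simp add: algebra_simps)
        ultimately show ?thesis by (simp add: V_def)
      qed
      thus ?thesis
        by (simp add: Finite_Cartesian_Product.vec_eq_iff smat_def shm_mult_fmat fmat_mult_shm idx_range)
    qed
    ultimately show ?thesis by (rule that)
  qed
  show ?thesis
    using img[OF UV(1,2)] unfolding UV(3) by (rule img4_similar[OF F(1)])
qed

section \<open>The standard polynomial\<close>

definition alternating4 :: "((nat \<Rightarrow> nat) \<Rightarrow> 'a::comm_ring_1) \<Rightarrow> bool" where
  "alternating4 \<alpha> \<longleftrightarrow> antisym_ends \<alpha> \<and> (\<forall>a b c d. {a, b, c, d} \<subseteq> {0..<4} \<longrightarrow> distinct [a, b, c, d] \<longrightarrow>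
     \<alpha> (perm4 a c b d) = - \<alpha> (perm4 a b c d))"

lemma alternating4_swap:
  assumes "alternating4 \<alpha>" "{a, b, c, d} \<subseteq> {0..<4}" "distinct [a, b, c, d]"
  shows "\<alpha> (perm4 b a c d) = - \<alpha> (perm4 a b c d)" "\<alpha> (perm4 a b d c) = - \<alpha> (perm4 a b c d)"
    "\<alpha> (perm4 a c b d) = - \<alpha> (perm4 a b c d)"
  using assms unfolding alternating4_def antisym_ends_def by blast+

lemma alternating4_values:
  assumes alt: "alternating4 \<alpha>"
  notes swap = alternating4_swap[OF alt]
  shows "\<alpha> (perm4 1 0 2 3) = - \<alpha> (perm4 0 1 2 3)" "\<alpha> (perm4 0 1 3 2) = - \<alpha> (perm4 0 1 2 3)"
    "\<alpha> (perm4 0 2 1 3) = - \<alpha> (perm4 0 1 2 3)" "\<alpha> (perm4 1 0 3 2) = \<alpha> (perm4 0 1 2 3)"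
    "\<alpha> (perm4 1 2 0 3) = \<alpha> (perm4 0 1 2 3)" "\<alpha> (perm4 0 3 1 2) = \<alpha> (perm4 0 1 2 3)"
    "\<alpha> (perm4 2 0 1 3) = \<alpha> (perm4 0 1 2 3)" "\<alpha> (perm4 0 2 3 1) = \<alpha> (perm4 0 1 2 3)"
    "\<alpha> (perm4 1 3 0 2) = - \<alpha> (perm4 0 1 2 3)" "\<alpha> (perm4 2 1 0 3) = - \<alpha> (perm4 0 1 2 3)"
    "\<alpha> (perm4 1 2 3 0) = - \<alpha> (perm4 0 1 2 3)" "\<alpha> (perm4 3 0 1 2) = - \<alpha> (perm4 0 1 2 3)"
    "\<alpha> (perm4 0 3 2 1) = - \<alpha> (perm4 0 1 2 3)" "\<alpha> (perm4 2 0 3 1) = - \<alpha> (perm4 0 1 2 3)"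
    "\<alpha> (perm4 3 1 0 2) = \<alpha> (perm4 0 1 2 3)" "\<alpha> (perm4 1 3 2 0) = \<alpha> (perm4 0 1 2 3)"
    "\<alpha> (perm4 2 1 3 0) = \<alpha> (perm4 0 1 2 3)" "\<alpha> (perm4 3 0 2 1) = \<alpha> (perm4 0 1 2 3)"
    "\<alpha> (perm4 2 3 0 1) = \<alpha> (perm4 0 1 2 3)" "\<alpha> (perm4 3 1 2 0) = - \<alpha> (perm4 0 1 2 3)"
    "\<alpha> (perm4 2 3 1 0) = - \<alpha> (perm4 0 1 2 3)" "\<alpha> (perm4 3 2 0 1) = - \<alpha> (perm4 0 1 2 3)"
    "\<alpha> (perm4 3 2 1 0) = \<alpha> (perm4 0 1 2 3)"
  using swap(1)[of 0 1 2 3] swap(2)[of 0 1 2 3] swap(3)[of 0 1 2 3] swap(2)[of 1 0 2 3] swap(3)[of 1 0 2 3] swap(3)[of 0 1 3 2]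
    swap(1)[of 0 2 1 3] swap(2)[of 0 2 1 3] swap(3)[of 1 0 3 2] swap(1)[of 1 2 0 3] swap(2)[of 1 2 0 3] swap(1)[of 0 3 1 2]
    swap(2)[of 0 3 1 2] swap(2)[of 2 0 1 3] swap(1)[of 1 3 0 2] swap(2)[of 1 3 0 2] swap(2)[of 2 1 0 3] swap(2)[of 3 0 1 2]
    swap(3)[of 2 0 3 1] swap(2)[of 3 1 0 2] swap(3)[of 2 1 3 0] swap(3)[of 3 0 2 1] swap(3)[of 3 1 2 0]
  by simp_all

text \<open>With weights \<open>i\<close> the commutator of the two shifts is the square of the
  plain shift, so the outer coefficients involve only \<open>d\<close>. The middle one vanishes for
  \<open>j = i + 1\<close>.\<close>

lemma eval_alternating4_two_shifts:
  fixes X :: "int \<Rightarrow> int \<Rightarrow> 'a::comm_ring_1" and x y :: "'n::finite" and d :: "int \<Rightarrow> 'a"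
  assumes alt: "alternating4 \<alpha>"
    and X: "\<And>i j. i \<ge> int CARD('n) \<Longrightarrow> X i j = 0" "\<And>i j. j < 0 \<Longrightarrow> X i j = 0"
  defines "a \<equiv> \<lambda>k. if k = 0 then fmat X else if k = 1 then shm 1 (\<lambda>_. 1) else if k = 2 then shm 1 of_int else shm 0 d"
    and "i \<equiv> idx x" and "j \<equiv> idx y"
  shows "eval_multilin4 \<alpha> a $ x $ y = \<alpha> (perm4 0 1 2 3) *
    ((d j - d i + d (i + 1) - d (i + 2)) * X (i + 2) j
     - of_int (j - 1 - i) * (d (i + 1) - d i + d j - d (j - 1)) * X (i + 1) (j - 1)
     + (d (j - 2) - d (j - 1) + d j - d i) * X i (j - 2))"
  unfolding eval_multilin4_expand a_def mat_1_eq_shm i_def[symmetric] j_def[symmetric]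
  by (simp add: shm_mult shm_fmat_shm[OF _ _ X] alternating4_values[OF alt] del: One_nat_def flip: i_def j_def)
    (simp add: algebra_simps)

lemma eval_alternating4_shift_diagonals:
  fixes X :: "int \<Rightarrow> int \<Rightarrow> 'a::comm_ring_1" and x y :: "'n::finite" and d e w :: "int \<Rightarrow> 'a"
  assumes alt: "alternating4 \<alpha>"
    and X: "\<And>i j. i \<ge> int CARD('n) \<Longrightarrow> X i j = 0" "\<And>i j. j < 0 \<Longrightarrow> X i j = 0"
  defines "a \<equiv> \<lambda>k. if k = 0 then fmat X else if k = 1 then shm 1 w else if k = 2 then shm 0 d else shm 0 e"
    and "i \<equiv> idx x" and "j \<equiv> idx y"
  shows "eval_multilin4 \<alpha> a $ x $ y = \<alpha> (perm4 0 1 2 3) *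
    (w i * X (i + 1) j * ((d (i + 1) - d i) * (e j - e (i + 1)) - (e (i + 1) - e i) * (d j - d (i + 1)))
     + X i (j - 1) * w (j - 1) * ((e (j - 1) - e i) * (d j - d (j - 1)) - (d (j - 1) - d i) * (e j - e (j - 1))))"
  unfolding eval_multilin4_expand a_def mat_1_eq_shm i_def[symmetric] j_def[symmetric]
  by (simp add: shm_mult shm_fmat_shm[OF _ _ X] alternating4_values[OF alt] del: One_nat_def flip: i_def j_def)
    (simp add: algebra_simps)

lemma sum_int_shift:
  fixes g :: "int \<Rightarrow> 'a::comm_monoid_add"
  assumes k: "0 \<le> k" and g: "\<And>i. i < 0 \<Longrightarrow> g i = 0" "\<And>i. N - k \<le> i \<Longrightarrow> g i = 0"
  shows "(\<Sum>i\<in>{0..<N}. g (i - k)) = (\<Sum>i\<in>{0..<N}. g i)"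
proof -
  have "(\<Sum>i\<in>{0..<N}. g (i - k)) = (\<Sum>i\<in>{- k..<N - k}. g i)"
    by (rule sum.reindex_bij_witness[of _ "\<lambda>i. i + k" "\<lambda>i. i - k"]) auto
  also have "\<dots> = (\<Sum>i\<in>{0..<N - k}. g i)"
    using k g by (intro sum.mono_neutral_right) auto
  also have "\<dots> = (\<Sum>i\<in>{0..<N}. g i)"
    using k g by (intro sum.mono_neutral_left) auto
  finally show ?thesis .
qed

text \<open>Take \<open>d i = x ^ i\<close> for \<open>i > 0\<close> and solve orthogonality for
  \<open>d 0\<close>. Each functional becomes a polynomial in \<open>x\<close>, which is nonzero
  because the functional is not proportional to \<open>t\<close>; some \<open>x\<close> avoids all
  roots.\<close>

lemma ex_orthogonal_avoiding:
  fixes t :: "int \<Rightarrow> 'a::field_char_0" and \<phi> :: "'p \<Rightarrow> int \<Rightarrow> 'a"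
  assumes N: "N > 0" and t0: "t 0 \<noteq> 0" and P: "finite P"
    and indep: "\<And>p. p \<in> P \<Longrightarrow> \<exists>i\<in>{0..<N}. \<phi> p i * t 0 \<noteq> \<phi> p 0 * t i"
  obtains d where "(\<Sum>i\<in>{0..<N}. t i * d i) = 0" "\<And>p. p \<in> P \<Longrightarrow> (\<Sum>i\<in>{0..<N}. \<phi> p i * d i) \<noteq> 0"
proof -
  have R: "{0..<N} = insert 0 {1..<N}" using N by auto
  define Q where "Q = (\<lambda>p. \<Sum>i\<in>{1..<N}. Polynomial.monom (\<phi> p i - \<phi> p 0 * t i / t 0) (nat i))"
  have Q0: "Q p \<noteq> 0" if p: "p \<in> P" for p
  proof -
    obtain i where i: "i \<in> {0..<N}" "\<phi> p i * t 0 \<noteq> \<phi> p 0 * t i" using indep[OF p] by blast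
    hence "i \<noteq> 0" by (metis mult.commute)
    hence i1: "i \<in> {1..<N}" using i(1) by auto
    have "coeff (Q p) (nat i) = (\<Sum>k\<in>{1..<N}. if k = i then \<phi> p k - \<phi> p 0 * t k / t 0 else 0)"
      unfolding Q_def coeff_sum using i1 by (intro sum.cong) auto
    also have "\<dots> = \<phi> p i - \<phi> p 0 * t i / t 0" using i1 by simp
    also have "\<dots> \<noteq> 0" using i(2) t0 by (auto simp: field_simps)
    finally show ?thesis by auto
  qed
  have "finite (\<Union>p\<in>P. {x. poly (Q p) x = 0})"
    using P Q0 by (auto intro: poly_roots_finite)
  from ex_new_if_finite[OF infinite_UNIV_char_0 this]
  obtain x where x: "\<And>p. p \<in> P \<Longrightarrow> poly (Q p) x \<noteq> 0" by auto
  define d where "d = (\<lambda>i. if i = 0 then - (\<Sum>i\<in>{1..<N}. t i * x ^ nat i) / t 0 else x ^ nat i)"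
  have dS: "(\<Sum>i\<in>{0..<N}. g i * d i) = g 0 * d 0 + (\<Sum>i\<in>{1..<N}. g i * x ^ nat i)" for g :: "int \<Rightarrow> 'a"
    unfolding R by (auto simp: d_def intro!: sum.cong)
  show ?thesis
  proof (rule that)
    show "(\<Sum>i\<in>{0..<N}. t i * d i) = 0" unfolding dS using t0 by (simp add: d_def)
    fix p assume p: "p \<in> P"
    have "(\<Sum>i\<in>{0..<N}. \<phi> p i * d i) = poly (Q p) x"
      unfolding dS Q_def poly_sum
      by (simp add: d_def poly_monom left_diff_distrib sum_subtractf sum_distrib_left sum_divide_distrib mult.assoc)
    thus "(\<Sum>i\<in>{0..<N}. \<phi> p i * d i) \<noteq> 0" using x[OF p] by simp
  qed
qed

text \<open>These expressions are the divisors in the row recursion for the standard polynomial. A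
  functional whose coefficient at 0 vanishes is not proportional to \<open>t\<close> because
  \<open>t 0 \<noteq> 0\<close>. Otherwise \<open>i = 0\<close>, and the critical ones are
  \<open>(-1, 2, -1)\<close> for \<open>N = 3\<close> and \<open>(-1, 1, -1, 0, ..., 0, 1)\<close>
  for \<open>N \<ge> 4\<close>, which the last two hypotheses exclude.\<close>

lemma ex_generic_diagonal:
  fixes t :: "int \<Rightarrow> 'a::field_char_0"
  assumes N: "N \<ge> 3" and t: "t 0 \<noteq> 0" "t (N - 1) \<noteq> 0" "N = 3 \<Longrightarrow> t 0 \<noteq> t 2"
    "N \<ge> 4 \<Longrightarrow> \<not> (t 1 = - t 0 \<and> t 2 = t 0 \<and> t (N - 1) = - t 0 \<and> (N \<ge> 5 \<longrightarrow> t (N - 2) = 0))"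
  obtains d where "(\<Sum>i\<in>{0..<N}. t i * d i) = 0"
    "\<And>i j. 0 \<le> i \<Longrightarrow> i + 2 < N \<Longrightarrow> i \<le> j \<Longrightarrow> j < N \<Longrightarrow> d j - d i + d (i + 1) - d (i + 2) \<noteq> 0"
proof -
  define \<phi> :: "int \<times> int \<Rightarrow> int \<Rightarrow> 'a" where "\<phi> = (\<lambda>(i, j) k. (if k = j then 1 else 0) - (if k = i then 1 else 0)
     + (if k = i + 1 then 1 else 0) - (if k = i + 2 then 1 else 0))"
  define P where "P = {(i, j). 0 \<le> i \<and> i + 2 < N \<and> i \<le> j \<and> j < N}"
  have fP: "finite P"
    by (rule finite_subset[of _ "{0..<N} \<times> {0..<N}"]) (auto simp: P_def)
  have ind: "\<exists>k\<in>{0..<N}. \<phi> p k * t 0 \<noteq> \<phi> p 0 * t k" if p: "p \<in> P" for p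
  proof -
    obtain i j where ij: "p = (i, j)" "0 \<le> i" "i + 2 < N" "i \<le> j" "j < N" using p by (auto simp: P_def)
    consider "\<phi> p 0 = 0" | "i = 0" "j = 1" "N = 3" | "i = 0" "j = N - 1" "N \<ge> 4" | "i = 0" "j > 0" "j \<noteq> N - 1" "N \<ge> 4" | "i = 0" "j = 2" "N = 3"
    proof (cases "i = 0 \<and> j \<noteq> 0")
      case False
      hence "\<phi> p 0 = 0" using ij by (auto simp: \<phi>_def)
      thus ?thesis using that by blast
    next
      case True
      thus ?thesis using that ij N by linarith
    qed
    thus ?thesis
    proof cases
      case 1
      have "\<phi> p (i + 1) \<noteq> 0" by (simp add: \<phi>_def ij(1))
      thus ?thesis using 1 t(1) ij by (intro bexI[of _ "i + 1"]) auto
    next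
      case 2
      thus ?thesis using t(3) by (intro bexI[of _ 2]) (auto simp: \<phi>_def ij(1))
    next
      case 3
      show ?thesis
      proof (rule ccontr)
        assume "\<not> ?thesis"
        hence *: "\<phi> p k * t 0 = \<phi> p 0 * t k" if "k \<in> {0..<N}" for k using that by blast
        have "t 1 = - t 0" "t 2 = t 0" "t (N - 1) = - t 0" "N \<ge> 5 \<longrightarrow> t (N - 2) = 0"
          using *[of 1] *[of 2] *[of "N - 1"] *[of "N - 2"] 3 by (auto simp: \<phi>_def ij(1))
        thus False using t(4) 3(3) by blast
      qed
    next
      case 4
      thus ?thesis using t(2) by (intro bexI[of _ "N - 1"]) (auto simp: \<phi>_def ij(1))
    next
      case 5
      thus ?thesis using t(2) by (intro bexI[of _ "N - 1"]) (auto simp: \<phi>_def ij(1))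
    qed
  qed
  have N0: "N > 0" using N by simp
  obtain d where d: "(\<Sum>i\<in>{0..<N}. t i * d i) = 0" "\<And>p. p \<in> P \<Longrightarrow> (\<Sum>i\<in>{0..<N}. \<phi> p i * d i) \<noteq> 0"
    using ex_orthogonal_avoiding[where \<phi> = \<phi> and P = P and t = t and N = N, OF N0 t(1) fP ind] by blast
  show ?thesis
  proof (rule that[OF d(1)])
    fix i j assume ij: "0 \<le> i" "i + 2 < N" "i \<le> j" "j < N"
    have "(\<Sum>k\<in>{0..<N}. \<phi> (i, j) k * d k) = d j - d i + d (i + 1) - d (i + 2)"
      using ij by (simp add: \<phi>_def distrib_right left_diff_distrib sum.distrib sum_subtractf if_distrib[of "\<lambda>x. x * _"] cong: if_cong)
    moreover have "(i, j) \<in> P" using ij by (simp add: P_def)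
    ultimately show "d j - d i + d (i + 1) - d (i + 2) \<noteq> 0" using d(2) by metis
  qed
qed

text \<open>If exactly one \<open>\<sigma> k\<close> is nonzero, then a solution needs \<open>y k = 0\<close>.\<close>

lemma ex_shift_weights:
  fixes \<sigma> :: "int \<Rightarrow> 'a::field_char_0"
  assumes N: "N \<ge> 3"
  obtains x y where "\<And>i. i \<in> {0..<N - 1} \<Longrightarrow> y (i + 1) * x i - x (i - 1) * y (i - 1) = \<sigma> i"
    "\<And>i. i < 0 \<Longrightarrow> x i = 0" "\<And>i. i \<ge> N - 2 \<Longrightarrow> x i = 0"
proof (cases "(\<forall>i\<in>{0..<N - 1}. \<sigma> i = 0) \<or> (\<exists>i\<in>{0..<N - 1}. \<exists>j\<in>{0..<N - 1}. i \<noteq> j \<and> \<sigma> i \<noteq> 0 \<and> \<sigma> j \<noteq> 0)")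
  case True
  obtain y where y: "\<And>i. y i \<noteq> 0" "(\<Sum>i\<in>{0..<N - 1}. \<sigma> i * y i) = 0"
    using ex_nonzero_weights[OF _ True] by auto
  \<comment> \<open>Multiplied by \<open>y i\<close>, the equation telescopes: \<open>g i\<close> is
    the intended value of \<open>y i * y (i + 1) * x i\<close>.\<close>
  define g where "g = (\<lambda>i. \<Sum>k\<in>{0..<i + 1}. \<sigma> k * y k)"
  have gS: "g i = g (i - 1) + \<sigma> i * y i" if "0 \<le> i" for i
  proof -
    have "{0..<i + 1} = insert i {0..<i}" using that by auto
    thus ?thesis by (simp add: g_def)
  qed
  have g0: "g (- 1) = 0" "g (N - 2) = 0" using y(2) by (simp_all add: g_def)
  define x where "x = (\<lambda>i. if 0 \<le> i \<and> i < N - 2 then g i / (y i * y (i + 1)) else 0)"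
  show ?thesis
  proof (rule that[of y x])
    fix i assume i: "i \<in> {0..<N - 1}"
    have "y (i + 1) * x i = g i / y i"
    proof (cases "i = N - 2")
      case True
      thus ?thesis using g0 by (simp add: x_def)
    next
      case False
      thus ?thesis using i y(1) by (simp add: x_def)
    qed
    moreover have "x (i - 1) * y (i - 1) = g (i - 1) / y i"
      using i y(1) g0 by (cases "i = 0") (simp_all add: x_def)
    ultimately have "y (i + 1) * x i - x (i - 1) * y (i - 1) = (g i - g (i - 1)) / y i"
      by (simp add: diff_divide_distrib)
    also have "\<dots> = \<sigma> i" using gS[of i] i y(1) by simp
    finally show "y (i + 1) * x i - x (i - 1) * y (i - 1) = \<sigma> i" .
  qed (auto simp: x_def)
next
  case False
  then obtain k where k: "k \<in> {0..<N - 1}" "\<sigma> k \<noteq> 0" by blast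
  hence z: "\<sigma> i = 0" if "i \<in> {0..<N - 1}" "i \<noteq> k" for i using that False by blast
  define y where "y = (\<lambda>i. if i = k then 0 else 1 :: 'a)"
  show ?thesis
  proof (cases "k < N - 2")
    case True
    show ?thesis
      by (rule that[of y "\<lambda>i. if i = k then \<sigma> k else 0"]) (use True k z in \<open>auto simp: y_def\<close>)
  next
    case False
    show ?thesis
      by (rule that[of y "\<lambda>i. if i = k - 1 then - \<sigma> k else 0"]) (use False N k z in \<open>auto simp: y_def\<close>)
  qed
qed

text \<open>The entry \<open>(i, j)\<close> of the standard polynomial at \<open>X\<close>, the shift, the shift with weights \<open>i\<close>, and \<open>diag d\<close>.\<close>

definition s4_op :: "(int \<Rightarrow> 'a::comm_ring_1) \<Rightarrow> (int \<Rightarrow> int \<Rightarrow> 'a) \<Rightarrow> int \<Rightarrow> int \<Rightarrow> 'a" where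
  "s4_op d X i j = (d j - d i + d (i + 1) - d (i + 2)) * X (i + 2) j
     - of_int (j - 1 - i) * (d (i + 1) - d i + d j - d (j - 1)) * X (i + 1) (j - 1)
     + (d (j - 2) - d (j - 1) + d j - d i) * X i (j - 2)"

text \<open>Rows \<open>0\<close> and \<open>1\<close> of \<open>X\<close> are free and set to zero; the equation \<open>s4_op d X = F\<close> in row \<open>i\<close> then
  determines row \<open>i + 2\<close>. The last two rows of \<open>F\<close> are constraints: the diagonal ones follow from two linear
  relations, and the entry \<open>(N - 2, N - 1)\<close> of \<open>F\<close> is adjusted by a transvection.\<close>

fun s4_rows :: "(int \<Rightarrow> int \<Rightarrow> 'a::field) \<Rightarrow> (int \<Rightarrow> 'a) \<Rightarrow> nat \<Rightarrow> int \<Rightarrow> 'a" where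
  "s4_rows F d 0 j = 0"
| "s4_rows F d (Suc 0) j = 0"
| "s4_rows F d (Suc (Suc n)) j = (let i = int n in
    (F i j + of_int (j - 1 - i) * (d (i + 1) - d i + d j - d (j - 1)) * s4_rows F d (Suc n) (j - 1)
      - (d (j - 2) - d (j - 1) + d j - d i) * s4_rows F d n (j - 2)) / (d j - d i + d (i + 1) - d (i + 2)))"

lemma s4_rows_below:
  assumes F: "\<And>i j. j < i \<Longrightarrow> F i j = 0"
  shows "j < int n - 2 \<Longrightarrow> s4_rows F d n j = 0"
proof (induction n arbitrary: j rule: induct_nat_012)
  case (ge2 n)
  have "F (int n) j = 0" "s4_rows F d (Suc n) (j - 1) = 0" "s4_rows F d n (j - 2) = 0"
    using ge2 F by auto
  thus ?case by (simp add: Let_def)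
qed auto

text \<open>The recursion never looks to the right. Hence changing the last column of the target
  does not affect the entry of \<open>X\<close> at \<open>(N - 2, N - 3)\<close>.\<close>

lemma s4_rows_cong:
  assumes "\<And>i k. k \<le> m \<Longrightarrow> F i k = F' i k"
  shows "j \<le> m \<Longrightarrow> s4_rows F d n j = s4_rows F' d n j"
proof (induction n arbitrary: j rule: induct_nat_012)
  case (ge2 n)
  have "F (int n) j = F' (int n) j" "s4_rows F d (Suc n) (j - 1) = s4_rows F' d (Suc n) (j - 1)"
    "s4_rows F d n (j - 2) = s4_rows F' d n (j - 2)"
    using ge2 assms by auto
  thus ?case by (simp add: Let_def)
qed auto

text \<open>Diagonal values involve only the entries \<open>X (i + 2) i\<close>; after an index
  shift the hypothesis on \<open>v\<close> says that each of them has coefficient zero. It holds for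
  \<open>v = 1\<close> and for \<open>v = d\<close>, which gives the two linear relations.\<close>

lemma s4_op_weighted_trace:
  fixes X :: "int \<Rightarrow> int \<Rightarrow> 'a::comm_ring_1"
  assumes X: "\<And>i j. i \<ge> N \<Longrightarrow> X i j = 0" "\<And>i j. j < 0 \<Longrightarrow> X i j = 0"
    and v: "\<And>i. v i * (d (i + 1) - d (i + 2)) + v (i + 1) * (d (i + 2) - d i) + v (i + 2) * (d i - d (i + 1)) = 0"
  shows "(\<Sum>i\<in>{0..<N}. v i * s4_op d X i i) = 0"
proof -
  define x where "x = (\<lambda>i. X (i + 2) i)"
  define B where "B = (\<lambda>i. v (i + 1) * (d (i + 2) - d i) * x i)"
  define C where "C = (\<lambda>i. v (i + 2) * (d i - d (i + 1)) * x i)"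
  have "v i * s4_op d X i i = v i * (d (i + 1) - d (i + 2)) * x i + B (i - 1) + C (i - 2)" for i
    by (simp add: s4_op_def x_def B_def C_def algebra_simps)
  hence "(\<Sum>i\<in>{0..<N}. v i * s4_op d X i i)
     = (\<Sum>i\<in>{0..<N}. v i * (d (i + 1) - d (i + 2)) * x i) + (\<Sum>i\<in>{0..<N}. B (i - 1)) + (\<Sum>i\<in>{0..<N}. C (i - 2))"
    by (simp add: sum.distrib)
  also have "(\<Sum>i\<in>{0..<N}. B (i - 1)) = (\<Sum>i\<in>{0..<N}. B i)"
    by (rule sum_int_shift) (auto simp: B_def x_def X)
  also have "(\<Sum>i\<in>{0..<N}. C (i - 2)) = (\<Sum>i\<in>{0..<N}. C i)"
    by (rule sum_int_shift) (auto simp: C_def x_def X)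
  also have "(\<Sum>i\<in>{0..<N}. v i * (d (i + 1) - d (i + 2)) * x i) + (\<Sum>i\<in>{0..<N}. B i) + (\<Sum>i\<in>{0..<N}. C i)
     = (\<Sum>i\<in>{0..<N}. (v i * (d (i + 1) - d (i + 2)) + v (i + 1) * (d (i + 2) - d i) + v (i + 2) * (d i - d (i + 1))) * x i)"
    by (simp add: sum.distrib B_def C_def distrib_right)
  finally show ?thesis by (simp add: v)
qed

lemma s4_op_surj:
  fixes F :: "int \<Rightarrow> int \<Rightarrow> 'a::field"
  assumes N: "N \<ge> 3" and F: "\<And>i j. j < i \<Longrightarrow> F i j = 0"
    and tr: "(\<Sum>i\<in>{0..<N}. F i i) = 0" "(\<Sum>i\<in>{0..<N}. d i * F i i) = 0"
    and d: "\<And>i j. 0 \<le> i \<Longrightarrow> i + 2 < N \<Longrightarrow> i \<le> j \<Longrightarrow> j < N \<Longrightarrow> d j - d i + d (i + 1) - d (i + 2) \<noteq> 0"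
    and last: "F (N - 2) (N - 1) = (d (N - 3) - d (N - 2) + d (N - 1) - d (N - 2)) * s4_rows F d (nat (N - 2)) (N - 3)"
  obtains X where "\<And>i j. i \<ge> N \<Longrightarrow> X i j = 0" "\<And>i j. j < 0 \<Longrightarrow> X i j = 0"
    "\<And>i j. i \<in> {0..<N} \<Longrightarrow> j \<in> {0..<N} \<Longrightarrow> s4_op d X i j = F i j"
proof -
  define X where "X = (\<lambda>i j. if 0 \<le> i \<and> i < N then s4_rows F d (nat i) j else 0)"
  have X1: "X i j = 0" if "i \<ge> N" for i j using that by (simp add: X_def)
  have X2: "X i j = 0" if "j < i - 2" for i j
    using that s4_rows_below[of F j "nat i" d] F by (auto simp: X_def)
  have X3: "X i j = 0" if "j < 0" for i j
  proof (cases "i \<in> {0, 1}")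
    case True
    then show ?thesis by (auto simp: X_def)
  next
    case False
    then show ?thesis using X2[of j i] that by (cases "i < 0") (auto simp: X_def)
  qed
  have rec: "s4_op d X i j = F i j" if ij: "0 \<le> i" "i + 2 < N" "0 \<le> j" "j < N" for i j
  proof (cases "j < i")
    case True
    then show ?thesis using F X2 by (simp add: s4_op_def)
  next
    case False
    define n where "n = nat i"
    have i: "i = int n" using ij by (simp add: n_def)
    have n: "nat (int n + 2) = Suc (Suc n)" "nat (int n + 1) = Suc n" by simp_all
    have "X (i + 2) j * (d j - d i + d (i + 1) - d (i + 2)) =
      F i j + of_int (j - 1 - i) * (d (i + 1) - d i + d j - d (j - 1)) * X (i + 1) (j - 1)
      - (d (j - 2) - d (j - 1) + d j - d i) * X i (j - 2)"
      using d[of i j] ij False unfolding i by (simp add: X_def Let_def n del: One_nat_def)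
    thus ?thesis by (simp add: s4_op_def mult.commute)
  qed
  \<comment> \<open>Diagonal errors can remain only in the last two rows. The two relations are a
    linear system for them, regular because \<open>d (N - 2) \<noteq> d (N - 1)\<close>, which is
    the genericity of \<open>d\<close> at \<open>i = j = N - 3\<close>.\<close>
  define E where "E = (\<lambda>i. F i i - s4_op d X i i)"
  have E0: "E i = 0" if "i \<in> {0..<N - 2}" for i using rec[of i i] that by (simp add: E_def)
  have R: "{0..<N} = insert (N - 1) (insert (N - 2) {0..<N - 2})" using N by auto
  have "(\<Sum>i\<in>{0..<N}. 1 * s4_op d X i i) = 0"
    by (rule s4_op_weighted_trace) (auto simp: X1 X3)
  hence "(\<Sum>i\<in>{0..<N}. E i) = 0" using tr(1) by (simp add: E_def sum_subtractf)
  hence s1: "E (N - 1) = - E (N - 2)" unfolding R using E0 by (simp add: eq_neg_iff_add_eq_0)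
  have "(\<Sum>i\<in>{0..<N}. d i * s4_op d X i i) = 0"
    by (rule s4_op_weighted_trace) (auto simp: X1 X3 algebra_simps)
  hence "(\<Sum>i\<in>{0..<N}. d i * E i) = 0" using tr(2) by (simp add: E_def right_diff_distrib sum_subtractf)
  hence "d (N - 1) * E (N - 1) + d (N - 2) * E (N - 2) = 0" unfolding R using E0 by (simp add: add.assoc)
  hence "(d (N - 2) - d (N - 1)) * E (N - 2) = 0" unfolding s1 by (simp add: algebra_simps)
  moreover have "d (N - 2) - d (N - 1) \<noteq> 0" using d[of "N - 3" "N - 3"] N by (simp add: algebra_simps)
  ultimately have E2: "E (N - 2) = 0" by simp
  hence E1: "E (N - 1) = 0" using s1 by simp
  show ?thesis
  proof (rule that[OF X1 X3])
    fix i j assume ij: "i \<in> {0..<N}" "j \<in> {0..<N}"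
    consider "i + 2 < N" | "i = N - 2" "j = N - 1" | "i = N - 1 \<or> i = N - 2" "j = i" | "i = N - 1 \<or> i = N - 2" "j < i"
      using ij by force
    thus "s4_op d X i j = F i j"
    proof cases
      case 1
      then show ?thesis using rec ij by simp
    next
      \<comment> \<open>Here the first term lies outside the matrix and the factor
        \<open>j - 1 - i\<close> is zero. Only the entry of \<open>X\<close> at
        \<open>(N - 2, N - 3)\<close> remains, which is already determined.\<close>
      case 2
      have "s4_op d X (N - 2) (N - 1) = (d (N - 3) - d (N - 2) + d (N - 1) - d (N - 2)) * X (N - 2) (N - 3)"
        using X1 by (simp add: s4_op_def)
      thus ?thesis using last N 2 by (simp add: X_def)
    next
      case 3
      then show ?thesis using E1 E2 by (auto simp: E_def)
    next
      case 4
      hence "s4_op d X i j = 0" using X1[of "i + 2" j] X1[of "i + 1" "j - 1"] X2 by (auto simp: s4_op_def)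
      thus ?thesis using F 4 by simp
    qed
  qed
qed

lemma similar_fmat_transvection:
  fixes F :: "int \<Rightarrow> int \<Rightarrow> 'a::comm_ring_1"
  assumes pq: "p \<in> {0..<int CARD('n)}" "q \<in> {0..<int CARD('n)}" "p \<noteq> q" and F: "F q p = 0"
  shows "similar (fmat F :: 'a^'n^'n::finite)
    (fmat (\<lambda>i j. F i j + (if i = p then c * F q j else 0) - (if j = q then c * F i p else 0)))"
proof -
  obtain a b :: 'n where ab: "idx a = p" "idx b = q" using idx_surj pq by (metis atLeastLessThan_iff)
  have "idx x = p \<longleftrightarrow> x = a" "idx x = q \<longleftrightarrow> x = b" for x using ab idx_inject by metis+
  moreover have "a \<noteq> b" using ab pq by auto
  moreover note similar_transvection[of a b "fmat F :: 'a^'n^'n" c]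
  moreover have "(\<chi> k l. (fmat F :: 'a^'n^'n) $ k $ l + (if k = a then c * fmat F $ b $ l else 0) - (if l = b then c * fmat F $ k $ a else 0)
      - (if k = a \<and> l = b then c * c * fmat F $ b $ a else 0))
    = (fmat (\<lambda>i j. F i j + (if i = p then c * F q j else 0) - (if j = q then c * F i p else 0)) :: 'a^'n^'n)"
    unfolding Finite_Cartesian_Product.vec_eq_iff using calculation(1,2) F by (simp add: ab)
  ultimately show ?thesis by simp
qed

text \<open>The two diagonal matrices have entries \<open>i\<close> and \<open>i\<^sup>2\<close>, which makes both coefficients of the system
  for the entries of \<open>X\<close> constant, equal to \<open>2\<close> and \<open>-2\<close>.\<close>

lemma img4_alternating_subdiagonal:
  fixes \<sigma> :: "int \<Rightarrow> 'a::field_char_0"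
  assumes n: "CARD('n) \<ge> 3" and alt: "alternating4 \<alpha>" and c: "\<alpha> (perm4 0 1 2 3) \<noteq> 0"
  shows "(fmat (\<lambda>i j. if i = j + 1 then \<sigma> j else 0) :: 'a^'n^'n::finite) \<in> img4 \<alpha>"
proof -
  let ?N = "int CARD('n)" and ?c = "\<alpha> (perm4 0 1 2 3)"
  have N: "?N \<ge> 3" using n by simp
  obtain x w where xw: "\<And>i. i \<in> {0..<?N - 1} \<Longrightarrow> w (i + 1) * x i - x (i - 1) * w (i - 1) = \<sigma> i / (2 * ?c)"
    "\<And>i. i < 0 \<Longrightarrow> x i = 0" "\<And>i. i \<ge> ?N - 2 \<Longrightarrow> x i = 0"
    by (rule ex_shift_weights[OF N, of "\<lambda>i. \<sigma> i / (2 * ?c)"]) (rule that)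
  define X where "X = (\<lambda>i j. if i = j + 2 then x j else 0)"
  have X: "\<And>i j. i \<ge> ?N \<Longrightarrow> X i j = 0" "\<And>i j. j < 0 \<Longrightarrow> X i j = 0"
    using xw(2,3) by (auto simp: X_def)
  define a :: "nat \<Rightarrow> 'a^'n^'n" where "a = (\<lambda>k. if k = 0 then fmat X else if k = 1 then shm 1 w
    else if k = 2 then shm 0 of_int else shm 0 (\<lambda>i. of_int (i * i)))"
  have "eval_multilin4 \<alpha> a $ p $ q = fmat (\<lambda>i j. if i = j + 1 then \<sigma> j else 0) $ p $ q" for p q
  proof (cases "idx p = idx q + 1")
    case True
    define j where "j = idx q"
    have p: "idx p = j + 1" using True by (simp add: j_def)
    have j: "j \<in> {0..<?N - 1}" using idx_range[of p] idx_range[of q] p by (simp add: j_def)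
    have "eval_multilin4 \<alpha> a $ p $ q = ?c * (2 * (w (j + 1) * x j - x (j - 1) * w (j - 1)))"
      unfolding a_def
      by (subst eval_alternating4_shift_diagonals[where X = X and 'n = 'n, OF alt X])
        (simp_all add: p X_def algebra_simps del: One_nat_def flip: j_def)
    also have "\<dots> = \<sigma> j" unfolding xw(1)[OF j] using c by simp
    finally show ?thesis using p by (simp add: j_def)
  next
    case False
    hence "X (idx p + 1) (idx q) = 0" "X (idx p) (idx q - 1) = 0" by (auto simp: X_def)
    thus ?thesis
      using False unfolding a_def by (subst eval_alternating4_shift_diagonals[where X = X and 'n = 'n, OF alt X]) simp_all
  qed
  hence "eval_multilin4 \<alpha> a = fmat (\<lambda>i j. if i = j + 1 then \<sigma> j else 0)"
    by (simp add: Finite_Cartesian_Product.vec_eq_iff)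
  thus ?thesis unfolding img4_def by (metis rangeI)
qed

lemma img4_trace_zero_of_alternating:
  fixes A :: "'a::{alg_closed_field, field_char_0}^'n^'n::finite"
  assumes n: "CARD('n) \<ge> 3" and tr: "trace A = 0" and alt: "alternating4 \<alpha>"
    and c: "\<alpha> (perm4 0 1 2 3) \<noteq> 0"
  shows "A \<in> img4 \<alpha>"
proof -
  let ?N = "int CARD('n)" and ?c = "\<alpha> (perm4 0 1 2 3)"
  have N: "?N \<ge> 3" using n by simp
  show ?thesis
  proof (rule similar_jordan_like_listed[OF n tr])
    fix t F assume F: "similar A (fmat F)" "jordan_like ?N t F" "\<And>i. i \<in> {0..<?N} \<Longrightarrow> t i = 0"
      "\<And>i j. j \<noteq> i \<Longrightarrow> j \<noteq> i + 1 \<Longrightarrow> F i j = 0"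
    \<comment> \<open>Reversing the indices moves the superdiagonal of the nilpotent Jordan form to
      the subdiagonal.\<close>
    define h where "h = (\<lambda>i. ?N - 1 - i)"
    have "bij_betw h {0..<?N} {0..<?N}"
      by (rule bij_betwI[of _ _ _ h]) (auto simp: h_def)
    hence "similar A (fmat (\<lambda>i j. F (h i) (h j)))"
      using similar_trans[OF F(1) similar_reindex] by blast
    also have "fmat (\<lambda>i j. F (h i) (h j)) = (fmat (\<lambda>i j. if i = j + 1 then F (h (j + 1)) (h j) else 0) :: 'a^'n^'n)"
    proof (rule fmat_cong)
      fix i j assume ij: "0 \<le> i" "i < ?N" "0 \<le> j" "j < ?N"
      have "F (h i) (h i) = 0" using F(2,3) ij by (auto simp: jordan_like_def h_def)
      thus "F (h i) (h j) = (if i = j + 1 then F (h (j + 1)) (h j) else 0)"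
        using F(4)[of "h j" "h i"] by (cases "i = j") (auto simp: h_def)
    qed
    finally show ?thesis
      by (rule img4_similar) (rule img4_alternating_subdiagonal[OF n alt c])
  next
    fix t F0 assume F0: "similar A (fmat F0)" "jordan_like ?N t F0" "(\<Sum>i\<in>{0..<?N}. t i) = 0"
      and t: "t 0 \<noteq> 0" "t (?N - 1) \<noteq> 0" "t (?N - 2) \<noteq> t (?N - 1)" "?N = 3 \<Longrightarrow> t 0 \<noteq> t 2"
      "?N \<ge> 4 \<Longrightarrow> \<not> (t 1 = - t 0 \<and> t 2 = t 0 \<and> t (?N - 1) = - t 0 \<and> (?N \<ge> 5 \<longrightarrow> t (?N - 2) = 0))"
    \<comment> \<open>Orthogonality to \<open>t\<close> is the second linear relation for a target
      whose diagonal is a multiple of \<open>t\<close>.\<close>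
    obtain d where dt: "(\<Sum>i\<in>{0..<?N}. t i * d i) = 0" and
      d: "\<And>i j. 0 \<le> i \<Longrightarrow> i + 2 < ?N \<Longrightarrow> i \<le> j \<Longrightarrow> j < ?N \<Longrightarrow> d j - d i + d (i + 1) - d (i + 2) \<noteq> 0"
      by (rule ex_generic_diagonal[where t = t, OF N t(1,2,4,5)]) (assumption | rule that)+
    \<comment> \<open>The cut below the diagonal also covers indices outside the matrix, as the row
      lemmas require. Dividing by \<open>?c\<close> compensates the coefficient of the standard
      polynomial.\<close>
    define F where "F = (\<lambda>i j. if j < i then 0 else F0 i j / ?c)"
    have Fu: "F i j = 0" if "j < i" for i j using that by (simp add: F_def)
    have Fd: "F i i = t i / ?c" if "i \<in> {0..<?N}" for i
      using F0(2) that by (auto simp: jordan_like_def F_def)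
    define v where "v = (d (?N - 3) - d (?N - 2) + d (?N - 1) - d (?N - 2)) * s4_rows F d (nat (?N - 2)) (?N - 3)"
    \<comment> \<open>The transvection changes the entry at \<open>(N - 2, N - 1)\<close> by
      \<open>k\<close> times the difference of the last two diagonal entries, and \<open>k\<close>
      makes it the required \<open>v\<close>. Computing \<open>v\<close> from \<open>F\<close> is
      legitimate because \<open>F\<close> and \<open>G\<close> agree in the columns up to
      \<open>N - 2\<close>.\<close>
    define k where "k = (v - F (?N - 2) (?N - 1)) / (F (?N - 1) (?N - 1) - F (?N - 2) (?N - 2))"
    define G where "G = (\<lambda>i j. F i j + (if i = ?N - 2 then k * F (?N - 1) j else 0) - (if j = ?N - 1 then k * F i (?N - 2) else 0))"
    have GF: "G i j = F i j" if "j \<le> ?N - 2" for i j using that Fu by (simp add: G_def)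
    have Gd: "G i i = F i i" for i
      using GF[of i i] Fu by (cases "i = ?N - 1") (auto simp: G_def)
    have Gu: "G i j = 0" if "j < i" for i j
      using that Fu by (auto simp: G_def)
    have "F (?N - 1) (?N - 1) - F (?N - 2) (?N - 2) \<noteq> 0"
      using Fd[of "?N - 1"] Fd[of "?N - 2"] N t(3) c by (simp flip: diff_divide_distrib)
    moreover have "G (?N - 2) (?N - 1) = F (?N - 2) (?N - 1) + k * (F (?N - 1) (?N - 1) - F (?N - 2) (?N - 2))"
      by (simp add: G_def algebra_simps)
    ultimately have "G (?N - 2) (?N - 1) = v"
      by (simp add: k_def)
    also have "v = (d (?N - 3) - d (?N - 2) + d (?N - 1) - d (?N - 2)) * s4_rows G d (nat (?N - 2)) (?N - 3)"
      unfolding v_def using s4_rows_cong[of "?N - 2" F G "?N - 3" d "nat (?N - 2)"] GF by simp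
    finally have last: "G (?N - 2) (?N - 1) = (d (?N - 3) - d (?N - 2) + d (?N - 1) - d (?N - 2)) * s4_rows G d (nat (?N - 2)) (?N - 3)" .
    have tr1: "(\<Sum>i\<in>{0..<?N}. G i i) = 0" and tr2: "(\<Sum>i\<in>{0..<?N}. d i * G i i) = 0"
      using F0(3) dt by (simp_all add: Gd Fd mult.commute flip: sum_divide_distrib)
    obtain X where X: "\<And>i j. i \<ge> ?N \<Longrightarrow> X i j = 0" "\<And>i j. j < 0 \<Longrightarrow> X i j = 0"
      "\<And>i j. i \<in> {0..<?N} \<Longrightarrow> j \<in> {0..<?N} \<Longrightarrow> s4_op d X i j = G i j"
      by (rule s4_op_surj[where F = G and d = d, OF N Gu tr1 tr2 d last]) (assumption | rule that)+
    define a :: "nat \<Rightarrow> 'a^'n^'n" where "a = (\<lambda>k. if k = 0 then fmat X else if k = 1 then shm 1 (\<lambda>_. 1)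
      else if k = 2 then shm 1 of_int else shm 0 d)"
    have "eval_multilin4 \<alpha> a $ p $ q = fmat (\<lambda>i j. ?c * G i j) $ p $ q" for p q
      unfolding a_def using X(3)[of "idx p" "idx q"]
      by (subst eval_alternating4_two_shifts[where X = X and 'n = 'n, OF alt X(1,2)]) (simp_all add: idx_range s4_op_def)
    hence "eval_multilin4 \<alpha> a = fmat (\<lambda>i j. ?c * G i j)"
      by (simp add: Finite_Cartesian_Product.vec_eq_iff)
    hence img: "fmat (\<lambda>i j. ?c * G i j) \<in> (img4 \<alpha> :: ('a^'n^'n) set)" unfolding img4_def by (metis rangeI)
    have "similar (fmat (\<lambda>i j. ?c * F i j) :: 'a^'n^'n) (fmat (\<lambda>i j. ?c * F i j
      + (if i = ?N - 2 then k * (?c * F (?N - 1) j) else 0) - (if j = ?N - 1 then k * (?c * F i (?N - 2)) else 0)))"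
      by (rule similar_fmat_transvection) (use N Fu in auto)
    also have "(\<lambda>i j. ?c * F i j + (if i = ?N - 2 then k * (?c * F (?N - 1) j) else 0)
        - (if j = ?N - 1 then k * (?c * F i (?N - 2)) else 0)) = (\<lambda>i j. ?c * G i j)"
      by (simp add: G_def fun_eq_iff algebra_simps)
    finally have "similar (fmat (\<lambda>i j. ?c * F i j) :: 'a^'n^'n) (fmat (\<lambda>i j. ?c * G i j))" .
    moreover have "fmat F0 = (fmat (\<lambda>i j. ?c * F i j) :: 'a^'n^'n)"
    proof (rule fmat_cong)
      fix i j assume ij: "0 \<le> i" "i < ?N" "0 \<le> j" "j < ?N"
      show "F0 i j = ?c * F i j"
        using jordan_like_nonzeroD[OF F0(2), of i j] ij c by (cases "F0 i j = 0") (auto simp: F_def)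
    qed
    ultimately have "similar (fmat F0 :: 'a^'n^'n) (fmat (\<lambda>i j. ?c * G i j))" by (simp only:)
    thus ?thesis by (rule img4_similar[OF similar_trans[OF F0(1)] img])
  qed
qed

section \<open>Relabelling and the three cases\<close>

lemma perm4_apply [simp]: "perm4 a b c d 0 = a" "perm4 a b c d 1 = b" "perm4 a b c d 2 = c" "perm4 a b c d 3 = d"
  by (simp_all add: perm4_def)

lemma permutes4_comp_perm4:
  assumes "\<tau> permutes {0..<4}"
  shows "\<tau> \<circ> perm4 a b c d = perm4 (\<tau> a) (\<tau> b) (\<tau> c) (\<tau> d)"
  using permutes_not_in[OF assms] by (auto simp: perm4_def fun_eq_iff)

lemma antisym_ends_comp:
  assumes "antisym_ends \<alpha>" and \<tau>: "\<tau> permutes {0..<4}"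
  shows "antisym_ends (\<lambda>\<sigma>. \<alpha> (\<tau> \<circ> \<sigma>))"
  unfolding antisym_ends_def
proof (intro allI impI)
  fix a b c d :: nat assume abcd: "{a, b, c, d} \<subseteq> {0..<4}" "distinct [a, b, c, d]"
  have "{\<tau> a, \<tau> b, \<tau> c, \<tau> d} \<subseteq> {0..<4}" "distinct [\<tau> a, \<tau> b, \<tau> c, \<tau> d]"
    using abcd permutes_in_image[OF \<tau>] permutes_inj[OF \<tau>] by (auto simp: inj_eq)
  thus "\<alpha> (\<tau> \<circ> perm4 b a c d) = - \<alpha> (\<tau> \<circ> perm4 a b c d) \<and> \<alpha> (\<tau> \<circ> perm4 a b d c) = - \<alpha> (\<tau> \<circ> perm4 a b c d)"
    using assms(1) unfolding permutes4_comp_perm4[OF \<tau>] antisym_ends_def by blast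
qed

theorem theorem4p1:
  fixes \<alpha> :: "(nat \<Rightarrow> nat) \<Rightarrow> 'a::{alg_closed_field, field_char_0}"
  assumes "CARD('n::finite) \<ge> 3"
    and "\<exists>\<sigma>. \<sigma> permutes {0..<4} \<and> \<alpha> \<sigma> \<noteq> 0"
  shows "{A :: 'a^'n^'n. trace A = 0} \<subseteq> {eval_multilin4 \<alpha> a | a. True}"
proof
  fix A :: "'a^'n^'n" assume "A \<in> {A. trace A = 0}"
  hence tr: "trace A = 0" by simp
  have relabel: "A \<in> img4 \<alpha>" if "\<tau> permutes {0..<4}" "A \<in> img4 (\<lambda>\<sigma>. \<alpha> (\<tau> \<circ> \<sigma>))" for \<tau>
    using img4_relabel[OF that(1)] that(2) by blast
  have "A \<in> img4 \<alpha>"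
  proof (cases "antisym_ends \<alpha>")
    case False
    then obtain a b c d where abcd: "{a, b, c, d} \<subseteq> {0..<4}" "distinct [a, b, c, d]"
      and ne: "\<alpha> (perm4 b a c d) \<noteq> - \<alpha> (perm4 a b c d) \<or> \<alpha> (perm4 a b d c) \<noteq> - \<alpha> (perm4 a b c d)"
      unfolding antisym_ends_def by blast
    from ne show ?thesis
    proof
      assume "\<alpha> (perm4 b a c d) \<noteq> - \<alpha> (perm4 a b c d)"
      hence s: "\<alpha> (perm4 a b c d) + \<alpha> (perm4 b a c d) \<noteq> 0" by (metis add_eq_0_iff)
      \<comment> \<open>The third letter \<open>c\<close> becomes the unknown variable, so the
        failing pair turns into the words \<open>1 2 0 3\<close> and \<open>2 1 0 3\<close>.\<close>
      have \<tau>: "perm4 c a b d permutes {0..<4}"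
        using abcd unfolding permutes4_iff by (intro exI[of _ c] exI[of _ a] exI[of _ b] exI[of _ d]) auto
      show ?thesis
        by (rule relabel[OF \<tau>], rule img4_trace_zero_of_diagonal_subst[OF _ tr])
          (use s in \<open>simp add: permutes4_comp_perm4[OF \<tau>] del: One_nat_def\<close>)
    next
      assume "\<alpha> (perm4 a b d c) \<noteq> - \<alpha> (perm4 a b c d)"
      hence s: "\<alpha> (perm4 a b c d) + \<alpha> (perm4 a b d c) \<noteq> 0" by (metis add_eq_0_iff)
      \<comment> \<open>Here the second letter \<open>b\<close> is the unknown one, giving the words
        \<open>1 0 2 3\<close> and \<open>1 0 3 2\<close>.\<close>
      have \<tau>: "perm4 b a c d permutes {0..<4}"
        using abcd unfolding permutes4_iff by (intro exI[of _ b] exI[of _ a] exI[of _ c] exI[of _ d]) auto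
      show ?thesis
        by (rule relabel[OF \<tau>], rule img4_trace_zero_of_diagonal_subst[OF _ tr])
          (use s in \<open>simp add: permutes4_comp_perm4[OF \<tau>] del: One_nat_def\<close>)
    qed
  next
    case anti: True
    show ?thesis
    proof (cases "alternating4 \<alpha>")
      case False
      then obtain a b c d where abcd: "{a, b, c, d} \<subseteq> {0..<4}" "distinct [a, b, c, d]"
        and ne: "\<alpha> (perm4 a c b d) \<noteq> - \<alpha> (perm4 a b c d)"
        using anti unfolding alternating4_def by blast
      have s: "\<alpha> (perm4 a b c d) + \<alpha> (perm4 a c b d) \<noteq> 0" using ne by (metis add_eq_0_iff)
      have \<tau>: "perm4 a b c d permutes {0..<4}" using abcd unfolding permutes4_iff by blast
      show ?thesis
        by (rule relabel[OF \<tau>], rule img4_trace_zero_of_commutators[OF assms(1) tr antisym_ends_comp[OF anti \<tau>]])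
          (use s in \<open>simp add: permutes4_comp_perm4[OF \<tau>] del: One_nat_def\<close>)
    next
      case alt: True
      obtain a b c d where abcd: "{a, b, c, d} \<subseteq> {0..<4}" "distinct [a, b, c, d]" "\<alpha> (perm4 a b c d) \<noteq> 0"
        using assms(2) unfolding permutes4_iff by blast
      have "\<alpha> (perm4 0 1 2 3) \<noteq> 0"
      proof
        assume z: "\<alpha> (perm4 0 1 2 3) = 0"
        have "x \<in> {0, 1, 2, 3}" if "x \<in> {a, b, c, d}" for x
          using abcd(1) that by auto
        hence "a \<in> {0, 1, 2, 3}" "b \<in> {0, 1, 2, 3}" "c \<in> {0, 1, 2, 3}" "d \<in> {0, 1, 2, 3}" by simp_all
        hence "\<alpha> (perm4 a b c d) = 0"
          using abcd(2) by (elim insertE emptyE; simp add: alternating4_values[OF alt] z del: One_nat_def)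
        thus False using abcd(3) by simp
      qed
      thus ?thesis by (rule img4_trace_zero_of_alternating[OF assms(1) tr alt])
    qed
  qed
  thus "A \<in> {eval_multilin4 \<alpha> a | a. True}" by (auto simp: img4_def)
qed

end
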